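(* Let $(\mathcal{M}, g, A)$ be a K\"ahler manifold of dimension $n$ with a quarter-symmetric metric $A$-connection $\overset{1}{\nabla}_XY=\overset{g}{\nabla}_XY-\pi(X)AY$ with generator $\pi$. The following relations hold for all vector fields $X,Y,Z$: $$4\overset{0}{H}(X,Y)Z-2\overset{1}{H}(X,Y)Z-\overset{2}{H}(X,Y)Z=\overset{g}{W}(X,Y)Z,$$ $$2\overset{5}{H}(X,Y)Z-\overset{1}{H}(X,Y)Z+\overset{1}{H}(Y,Z)X=\overset{g}{W}(X,Z)Y,$$ where $\overset{g}{W}$ is the Weyl projective curvature tensor of $g$ and $\overset{0}{H},\overset{1}{H},\overset{2}{H},\overset{5}{H}$ are the tensors defined in the context.
   Context: A K\"ahler manifold $(\mathcal{M},g,A)$ is a Riemannian manifold $(\mathcal{M},g)$ of dimension $n=2k\ge4$ with a $(1,1)$ tensor field $A$ satisfying $A^2=-I$, $g(AX,AY)=g(X,Y)$ and $\overset{g}{\nabla}A=0$, where $\overset{g}{\nabla}$ is the Levi-Civita connection. $\overset{g}{R}$ is the Riemannian curvature tensor of $g$, $\overset{g}{R}(X,Y)Z=\overset{g}{\nabla}_X\overset{g}{\nabla}_YZ-\overset{g}{\nabla}_Y\overset{g}{\nabla}_XZ-\overset{g}{\nabla}_{[X,Y]}Z$, $\overset{g}{R}ic(Y,Z)=\mathrm{Trace}\{X\mapsto\overset{g}{R}(X,Y)Z\}$, and the Weyl projective curvature tensor is $\overset{g}{W}(X,Y)Z=\overset{g}{R}(X,Y)Z+\frac{1}{n-1}(\overset{g}{R}ic(X,Z)Y-\overset{g}{R}ic(Y,Z)X)$.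 For a 1-form $\pi$ put $$\overset{0}{D}(X,Y)=(\overset{g}{\nabla}_X\pi)(Y)+\tfrac12\pi(X)\pi(AY)+\tfrac12\pi(Y)\pi(AX),\quad \overset{1}{D}(X,Y)=(\overset{g}{\nabla}_X\pi)(Y)-(\overset{g}{\nabla}_Y\pi)(X),$$ $$\overset{2}{D}(X,Y)=(\overset{g}{\nabla}_X\pi)(Y)+\pi(Y)\pi(AX),\quad \overset{3}{D}(X,Y)=(\overset{g}{\nabla}_X\pi)(Y)+\pi(X)\pi(AY),$$ and define the curvature tensors $$\overset{0}{R}(X,Y)Z=\overset{g}{R}(X,Y)Z-\tfrac12\big(\overset{0}{D}(X,Y)-\overset{0}{D}(Y,X)\big)AZ-\tfrac12\overset{0}{D}(X,Z)AY+\tfrac12\overset{0}{D}(Y,Z)AX+\tfrac14\pi(Z)\big(\pi(Y)X-\pi(X)Y\big),$$ $$\overset{1}{R}(X,Y)Z=\overset{g}{R}(X,Y)Z-\overset{1}{D}(X,Y)AZ,$$ $$\overset{2}{R}(X,Y)Z=\overset{g}{R}(X,Y)Z-\overset{2}{D}(X,Z)AY+\overset{2}{D}(Y,Z)AX,$$ $$\overset{3}{R}(X,Y)Z=\overset{g}{R}(X,Y)Z-\overset{2}{D}(X,Y)AZ+\overset{3}{D}(Y,Z)AX,$$ $$\overset{5}{R}(X,Y)Z=\overset{g}{R}(X,Y)Z-\tfrac12\big(\overset{2}{D}(X,Y)-\overset{3}{D}(Y,X)\big)AZ-\tfrac12\overset{3}{D}(X,Z)AY+\tfrac12\overset{2}{D}(Y,Z)AX-\tfrac12\pi(Y)\big(\pi(X)Z-\pi(Z)X\big),$$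 with $\overset{\theta}{R}ic(Y,Z)=\mathrm{Trace}\{X\mapsto\overset{\theta}{R}(X,Y)Z\}$ and $\overset{3}{'R}(X,Y)=\mathrm{Trace}\{Z\mapsto\overset{3}{R}(X,Y)Z\}$. Finally define $$\overset{1}{H}(X,Y)Z=\overset{1}{R}(X,Y)Z+\overset{1}{R}ic(Y,AX)AZ,$$ $$\overset{2}{H}(X,Y)Z=\overset{2}{R}(X,Y)Z+\overset{2}{R}ic(AX,Z)AY-\overset{2}{R}ic(AY,Z)AX,$$ $$\begin{aligned}\overset{5}{H}(X,Y)Z={}&\overset{5}{R}(X,Y)Z+\tfrac{1}{n-1}\big(\overset{5}{R}ic(X,Y)Z-\overset{5}{R}ic(Y,Z)X\big)-\tfrac{1}{2(n-1)}\big(\overset{1}{R}ic(X,Y)Z-\overset{1}{R}ic(Y,Z)X\big)\\&-\tfrac{1}{2(n-1)}\big(\overset{3}{'R}(AY,AX)Z-\overset{3}{'R}(AZ,AY)X\big)+\tfrac12\big(\overset{1}{R}ic(Y,AX)AZ-\overset{3}{R}ic(Z,AY)AX-\overset{3}{'R}(AZ,X)AY\big),\end{aligned}$$ $$\begin{aligned}\overset{0}{H}(X,Y)Z={}&\overset{0}{R}(X,Y)Z+\tfrac{1}{n-1}\big(\overset{0}{R}ic(X,Z)Y-\overset{0}{R}ic(Y,Z)X\big)-\tfrac{1}{2(n-1)}\big(\overset{1}{R}ic(X,Z)Y-\overset{1}{R}ic(Y,Z)X\big)\\&-\tfrac{1}{4(n-1)}\big(\overset{3}{R}ic(Z,X)Y-\overset{3}{R}ic(Z,Y)X+\overset{3}{'R}(AZ,AX)Y-\overset{3}{'R}(AZ,AY)X\big)\\&+\tfrac14\big(2\overset{1}{R}ic(Y,AX)AZ+\overset{3}{R}ic(Z,AX)AY-\overset{3}{R}ic(Z,AY)AX\big)-\tfrac14\big(\overset{3}{'R}(AZ,X)AY-\overset{3}{'R}(AZ,Y)AX\big).\end{aligned}$$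 *)

theory Defs
  imports "HOL-Analysis.Analysis" "HOL-Library.Function_Algebras"
begin

section \<open>Pointwise real vector space structure on functions\<close>

instantiation "fun" :: (type, real_vector) real_vector
begin

definition scaleR_fun :: "real \<Rightarrow> ('a \<Rightarrow> 'b) \<Rightarrow> 'a \<Rightarrow> 'b" where
  "scaleR_fun c f = (\<lambda>x. c *\<^sub>R f x)"

instance
  by standard (simp_all add: scaleR_fun_def plus_fun_def fun_eq_iff algebra_simps)

end

section \<open>Smooth manifolds\<close>

primrec Ck_on :: "nat \<Rightarrow> 'a::euclidean_space set \<Rightarrow> ('a \<Rightarrow> 'b::euclidean_space) \<Rightarrow> bool" where
  "Ck_on 0 S f \<longleftrightarrow> continuous_on S f"
| "Ck_on (Suc k) S f \<longleftrightarrow>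
     (\<forall>x\<in>S. f differentiable (at x)) \<and>
     (\<forall>v. Ck_on k S (\<lambda>x. frechet_derivative f (at x) v))"

text \<open>Only used for open sets.\<close>

definition smooth_on :: "'a::euclidean_space set \<Rightarrow> ('a \<Rightarrow> 'b::euclidean_space) \<Rightarrow> bool" where
  "smooth_on S f \<longleftrightarrow> (\<forall>k. Ck_on k S f)"

text \<open>A topological space with an atlas; a chart is its domain together with its coordinate map.\<close>

record ('a, 'n) atlas_space =
  mtop :: "'a topology"
  charts :: "('a set \<times> ('a \<Rightarrow> real ^ 'n)) set"

definition smooth_manifold :: "('a, 'n::finite) atlas_space \<Rightarrow> bool" where
  "smooth_manifold M \<longleftrightarrow>
     Hausdorff_space (mtop M) \<and> second_countable (mtop M) \<and>
     (\<forall>(U, \<phi>) \<in> charts M. openin (mtop M) U \<and> open (\<phi> ` U) \<and>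
        homeomorphic_map (subtopology (mtop M) U) (top_of_set (\<phi> ` U)) \<phi>) \<and>
     (\<Union>(U, \<phi>) \<in> charts M. U) = topspace (mtop M) \<and>
     (\<forall>(U, \<phi>) \<in> charts M. \<forall>(V, \<psi>) \<in> charts M.
        smooth_on (\<phi> ` (U \<inter> V)) (\<psi> \<circ> inv_into U \<phi>))"

definition smooth_fun_on :: "('a, 'n::finite) atlas_space \<Rightarrow> 'a set \<Rightarrow> ('a \<Rightarrow> real) \<Rightarrow> bool" where
  "smooth_fun_on M W f \<longleftrightarrow> openin (mtop M) W \<and>
     (\<forall>(U, \<phi>) \<in> charts M. smooth_on (\<phi> ` (U \<inter> W)) (f \<circ> inv_into U \<phi>))"

definition smooth_near :: "('a, 'n::finite) atlas_space \<Rightarrow> 'a \<Rightarrow> ('a \<Rightarrow> real) \<Rightarrow> bool" where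
  "smooth_near M p f \<longleftrightarrow> (\<exists>W. p \<in> W \<and> smooth_fun_on M W f)"

subsection \<open>Tangent vectors and vector fields\<close>

text \<open>
  A tangent vector at a point is identified with the directional derivative that it induces on the
  functions that are smooth near the point. As functions are total in HOL, its value on all other
  functions is fixed to be 0, so that equality of tangent vectors is equality of functionals.
\<close>

type_synonym 'a tvec = "('a \<Rightarrow> real) \<Rightarrow> real"
type_synonym 'a field = "'a \<Rightarrow> 'a tvec"

definition chart_deriv ::
  "('a, 'n::finite) atlas_space \<Rightarrow> 'a set \<times> ('a \<Rightarrow> real ^ 'n) \<Rightarrow> real ^ 'n \<Rightarrow> 'a field" where
  "chart_deriv M = (\<lambda>(U, \<phi>) w p f.
     if smooth_near M p f then frechet_derivative (f \<circ> inv_into U \<phi>) (at (\<phi> p)) w else 0)"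

definition tangent_space :: "('a, 'n::finite) atlas_space \<Rightarrow> 'a \<Rightarrow> 'a tvec set" where
  "tangent_space M p = {chart_deriv M c w p | c w. c \<in> charts M \<and> p \<in> fst c}"

text \<open>
  Vector fields are total functions that are only meaningful on the open set W. Taking all open W
  into account makes local fields, such as coordinate fields, available to connections and
  curvature.
\<close>

definition vector_field_on :: "('a, 'n::finite) atlas_space \<Rightarrow> 'a set \<Rightarrow> 'a field \<Rightarrow> bool" where
  "vector_field_on M W X \<longleftrightarrow> openin (mtop M) W \<and> (\<forall>p\<in>W. X p \<in> tangent_space M p) \<and>
     (\<forall>V f. V \<subseteq> W \<and> smooth_fun_on M V f \<longrightarrow> smooth_fun_on M V (\<lambda>p. X p f))"

abbreviation vector_field :: "('a, 'n::finite) atlas_space \<Rightarrow> 'a field \<Rightarrow> bool" where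
  "vector_field M X \<equiv> vector_field_on M (topspace (mtop M)) X"

definition lie_bracket :: "('a, 'n::finite) atlas_space \<Rightarrow> 'a field \<Rightarrow> 'a field \<Rightarrow> 'a field" where
  "lie_bracket M X Y = (\<lambda>p f.
     if smooth_near M p f then X p (\<lambda>q. Y q f) - Y p (\<lambda>q. X q f) else 0)"

definition fscale :: "('a \<Rightarrow> real) \<Rightarrow> 'a field \<Rightarrow> 'a field" (infixr "\<odot>" 75) where
  "f \<odot> X = (\<lambda>p. f p *\<^sub>R X p)"

text \<open>Application of a field of maps (a 1-form or a (1,1) tensor field) to a vector field.\<close>

definition tapp :: "('a \<Rightarrow> 'a tvec \<Rightarrow> 'b) \<Rightarrow> 'a field \<Rightarrow> 'a \<Rightarrow> 'b" (infixr "\<diamondop>" 90) where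
  "T \<diamondop> X = (\<lambda>p. T p (X p))"

subsection \<open>Tensor fields\<close>

definition linear_at ::
  "('a, 'n::finite) atlas_space \<Rightarrow> 'a \<Rightarrow> ('a tvec \<Rightarrow> 'b::real_vector) \<Rightarrow> bool" where
  "linear_at M p L \<longleftrightarrow>
     (\<forall>v\<in>tangent_space M p. \<forall>w\<in>tangent_space M p. L (v + w) = L v + L w) \<and>
     (\<forall>v\<in>tangent_space M p. \<forall>c. L (c *\<^sub>R v) = c *\<^sub>R L v)"

definition one_form ::
  "('a, 'n::finite) atlas_space \<Rightarrow> ('a \<Rightarrow> 'a tvec \<Rightarrow> real) \<Rightarrow> bool" where
  "one_form M \<pi> \<longleftrightarrow> (\<forall>p\<in>topspace (mtop M). linear_at M p (\<pi> p)) \<and>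
     (\<forall>W X. vector_field_on M W X \<longrightarrow> smooth_fun_on M W (\<pi> \<diamondop> X))"

definition endomorphism_field ::
  "('a, 'n::finite) atlas_space \<Rightarrow> ('a \<Rightarrow> 'a tvec \<Rightarrow> 'a tvec) \<Rightarrow> bool" where
  "endomorphism_field M A \<longleftrightarrow>
     (\<forall>p\<in>topspace (mtop M). linear_at M p (A p) \<and> A p ` tangent_space M p \<subseteq> tangent_space M p) \<and>
     (\<forall>W X. vector_field_on M W X \<longrightarrow> vector_field_on M W (A \<diamondop> X))"

definition riemannian_metric ::
  "('a, 'n::finite) atlas_space \<Rightarrow> ('a \<Rightarrow> 'a tvec \<Rightarrow> 'a tvec \<Rightarrow> real) \<Rightarrow> bool" where
  "riemannian_metric M g \<longleftrightarrow>
     (\<forall>p\<in>topspace (mtop M). \<forall>v\<in>tangent_space M p.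
        linear_at M p (g p v) \<and>
        (\<forall>w\<in>tangent_space M p. g p v w = g p w v) \<and>
        (v \<noteq> 0 \<longrightarrow> g p v v > 0)) \<and>
     (\<forall>W X Y. vector_field_on M W X \<and> vector_field_on M W Y \<longrightarrow>
        smooth_fun_on M W (\<lambda>p. g p (X p) (Y p)))"

subsection \<open>Connections\<close>

text \<open>
  Connections are local operators; here they act on vector fields over arbitrary open sets
  compatibly with restriction, which is what the last clause says.
\<close>

definition linear_connection ::
  "('a, 'n::finite) atlas_space \<Rightarrow> ('a field \<Rightarrow> 'a field \<Rightarrow> 'a field) \<Rightarrow> bool" where
  "linear_connection M nabla \<longleftrightarrow>
     (\<forall>W X X' Y Y' f.
        vector_field_on M W X \<and> vector_field_on M W X' \<and>
        vector_field_on M W Y \<and> vector_field_on M W Y' \<and> smooth_fun_on M W f \<longrightarrow>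
        vector_field_on M W (nabla X Y) \<and>
        (\<forall>p\<in>W.
           nabla (X + X') Y p = nabla X Y p + nabla X' Y p \<and>
           nabla (f \<odot> X) Y p = f p *\<^sub>R nabla X Y p \<and>
           nabla X (Y + Y') p = nabla X Y p + nabla X Y' p \<and>
           nabla X (f \<odot> Y) p = X p f *\<^sub>R Y p + f p *\<^sub>R nabla X Y p) \<and>
        ((\<forall>p\<in>W. X p = X' p \<and> Y p = Y' p) \<longrightarrow> (\<forall>p\<in>W. nabla X Y p = nabla X' Y' p)))"

definition torsion ::
  "('a, 'n::finite) atlas_space \<Rightarrow> ('a field \<Rightarrow> 'a field \<Rightarrow> 'a field) \<Rightarrow>
   'a field \<Rightarrow> 'a field \<Rightarrow> 'a field" where
  "torsion M nabla X Y = nabla X Y - nabla Y X - lie_bracket M X Y"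

definition parallel_metric ::
  "('a, 'n::finite) atlas_space \<Rightarrow> ('a field \<Rightarrow> 'a field \<Rightarrow> 'a field) \<Rightarrow>
   ('a \<Rightarrow> 'a tvec \<Rightarrow> 'a tvec \<Rightarrow> real) \<Rightarrow> bool" where
  "parallel_metric M nabla g \<longleftrightarrow>
     (\<forall>W X Y Z. vector_field_on M W X \<and> vector_field_on M W Y \<and> vector_field_on M W Z \<longrightarrow>
        (\<forall>p\<in>W. X p (\<lambda>q. g q (Y q) (Z q)) = g p (nabla X Y p) (Z p) + g p (Y p) (nabla X Z p)))"

definition parallel_endomorphism ::
  "('a, 'n::finite) atlas_space \<Rightarrow> ('a field \<Rightarrow> 'a field \<Rightarrow> 'a field) \<Rightarrow>
   ('a \<Rightarrow> 'a tvec \<Rightarrow> 'a tvec) \<Rightarrow> bool" where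
  "parallel_endomorphism M nabla A \<longleftrightarrow>
     (\<forall>W X Y. vector_field_on M W X \<and> vector_field_on M W Y \<longrightarrow>
        (\<forall>p\<in>W. nabla X (A \<diamondop> Y) p = (A \<diamondop> nabla X Y) p))"

definition levi_civita_connection ::
  "('a, 'n::finite) atlas_space \<Rightarrow> ('a \<Rightarrow> 'a tvec \<Rightarrow> 'a tvec \<Rightarrow> real) \<Rightarrow>
   ('a field \<Rightarrow> 'a field \<Rightarrow> 'a field) \<Rightarrow> bool" where
  "levi_civita_connection M g nabla \<longleftrightarrow>
     linear_connection M nabla \<and> parallel_metric M nabla g \<and>
     (\<forall>W X Y. vector_field_on M W X \<and> vector_field_on M W Y \<longrightarrow>
        (\<forall>p\<in>W. torsion M nabla X Y p = 0))"

text \<open>The Levi-Civita connection is carried along as an explicit argument.\<close>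

definition kaehler_manifold ::
  "('a, 'n::finite) atlas_space \<Rightarrow> ('a \<Rightarrow> 'a tvec \<Rightarrow> 'a tvec \<Rightarrow> real) \<Rightarrow>
   ('a \<Rightarrow> 'a tvec \<Rightarrow> 'a tvec) \<Rightarrow> ('a field \<Rightarrow> 'a field \<Rightarrow> 'a field) \<Rightarrow> bool" where
  "kaehler_manifold M g A nabla \<longleftrightarrow>
     smooth_manifold M \<and> even CARD('n) \<and> CARD('n) \<ge> 4 \<and>
     riemannian_metric M g \<and> levi_civita_connection M g nabla \<and>
     endomorphism_field M A \<and>
     (\<forall>p\<in>topspace (mtop M). \<forall>v\<in>tangent_space M p. A p (A p v) = - v) \<and>
     (\<forall>p\<in>topspace (mtop M). \<forall>v\<in>tangent_space M p. \<forall>w\<in>tangent_space M p.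
        g p (A p v) (A p w) = g p v w) \<and>
     parallel_endomorphism M nabla A"

definition quarter_symmetric_metric_A_connection ::
  "('a, 'n::finite) atlas_space \<Rightarrow> ('a \<Rightarrow> 'a tvec \<Rightarrow> 'a tvec \<Rightarrow> real) \<Rightarrow>
   ('a \<Rightarrow> 'a tvec \<Rightarrow> 'a tvec) \<Rightarrow> ('a \<Rightarrow> 'a tvec \<Rightarrow> real) \<Rightarrow>
   ('a field \<Rightarrow> 'a field \<Rightarrow> 'a field) \<Rightarrow> bool" where
  "quarter_symmetric_metric_A_connection M g A \<pi> nabla \<longleftrightarrow>
     linear_connection M nabla \<and> parallel_metric M nabla g \<and> parallel_endomorphism M nabla A \<and>
     (\<forall>W X Y. vector_field_on M W X \<and> vector_field_on M W Y \<longrightarrow>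
        (\<forall>p\<in>W. torsion M nabla X Y p = ((\<pi> \<diamondop> Y) \<odot> (A \<diamondop> X) - (\<pi> \<diamondop> X) \<odot> (A \<diamondop> Y)) p))"

section \<open>Curvature, traces and Ricci tensors\<close>

definition curvature ::
  "('a, 'n::finite) atlas_space \<Rightarrow> ('a field \<Rightarrow> 'a field \<Rightarrow> 'a field) \<Rightarrow>
   'a field \<Rightarrow> 'a field \<Rightarrow> 'a field \<Rightarrow> 'a field" where
  "curvature M nabla X Y Z = nabla X (nabla Y Z) - nabla Y (nabla X Z) - nabla (lie_bracket M X Y) Z"

text \<open>
  Pointwise trace of a map E of vector fields that is linear over smooth functions, i.e. of a field
  of endomorphisms of the tangent spaces: the sum of the diagonal entries of its matrix in the
  coordinate basis of a chart around p. The i-th coefficient of a tangent vector in that basis is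
  its value on the i-th coordinate function.
\<close>

definition trace_field :: "('a, 'n::finite) atlas_space \<Rightarrow> ('a field \<Rightarrow> 'a field) \<Rightarrow> 'a \<Rightarrow> real" where
  "trace_field M E p =
     (let c = (SOME c. c \<in> charts M \<and> p \<in> fst c)
      in \<Sum>i\<in>UNIV. E (chart_deriv M c (axis i 1)) p (\<lambda>q. snd c q $ i))"

definition ricci ::
  "('a, 'n::finite) atlas_space \<Rightarrow> ('a field \<Rightarrow> 'a field \<Rightarrow> 'a field \<Rightarrow> 'a field) \<Rightarrow>
   'a field \<Rightarrow> 'a field \<Rightarrow> 'a \<Rightarrow> real" where
  "ricci M R Y Z = trace_field M (\<lambda>X. R X Y Z)"

definition ricci' ::
  "('a, 'n::finite) atlas_space \<Rightarrow> ('a field \<Rightarrow> 'a field \<Rightarrow> 'a field \<Rightarrow> 'a field) \<Rightarrow>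
   'a field \<Rightarrow> 'a field \<Rightarrow> 'a \<Rightarrow> real" where
  "ricci' M R X Y = trace_field M (\<lambda>Z. R X Y Z)"

definition weyl_projective ::
  "('a, 'n::finite) atlas_space \<Rightarrow> ('a field \<Rightarrow> 'a field \<Rightarrow> 'a field) \<Rightarrow>
   'a field \<Rightarrow> 'a field \<Rightarrow> 'a field \<Rightarrow> 'a field" where
  "weyl_projective M nabla X Y Z =
     (let R = curvature M nabla; Ric = ricci M R; n = real CARD('n)
      in R X Y Z + (1 / (n - 1)) *\<^sub>R (Ric X Z \<odot> Y - Ric Y Z \<odot> X))"

section \<open>The tensors built from the generator\<close>

text \<open>
  Below, \<open>nabla\<close> is the Levi-Civita connection, and sums, products and scalar multiples of functions
  and of vector fields are pointwise.
\<close>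

definition cov_form ::
  "('a field \<Rightarrow> 'a field \<Rightarrow> 'a field) \<Rightarrow> ('a \<Rightarrow> 'a tvec \<Rightarrow> real) \<Rightarrow>
   'a field \<Rightarrow> 'a field \<Rightarrow> 'a \<Rightarrow> real" where
  "cov_form nabla \<pi> X Y = (\<lambda>p. X p (\<pi> \<diamondop> Y) - (\<pi> \<diamondop> nabla X Y) p)"

context
  fixes nabla :: "'a field \<Rightarrow> 'a field \<Rightarrow> 'a field"
    and A :: "'a \<Rightarrow> 'a tvec \<Rightarrow> 'a tvec"
    and \<pi> :: "'a \<Rightarrow> 'a tvec \<Rightarrow> real"
begin

definition D0 :: "'a field \<Rightarrow> 'a field \<Rightarrow> 'a \<Rightarrow> real" where
  "D0 X Y = cov_form nabla \<pi> X Y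
     + (1/2) *\<^sub>R ((\<pi> \<diamondop> X) * (\<pi> \<diamondop> A \<diamondop> Y)) + (1/2) *\<^sub>R ((\<pi> \<diamondop> Y) * (\<pi> \<diamondop> A \<diamondop> X))"

definition D1 :: "'a field \<Rightarrow> 'a field \<Rightarrow> 'a \<Rightarrow> real" where
  "D1 X Y = cov_form nabla \<pi> X Y - cov_form nabla \<pi> Y X"

definition D2 :: "'a field \<Rightarrow> 'a field \<Rightarrow> 'a \<Rightarrow> real" where
  "D2 X Y = cov_form nabla \<pi> X Y + (\<pi> \<diamondop> Y) * (\<pi> \<diamondop> A \<diamondop> X)"

definition D3 :: "'a field \<Rightarrow> 'a field \<Rightarrow> 'a \<Rightarrow> real" where
  "D3 X Y = cov_form nabla \<pi> X Y + (\<pi> \<diamondop> X) * (\<pi> \<diamondop> A \<diamondop> Y)"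

context
  fixes M :: "('a, 'n::finite) atlas_space"
begin

definition R0 :: "'a field \<Rightarrow> 'a field \<Rightarrow> 'a field \<Rightarrow> 'a field" where
  "R0 X Y Z = curvature M nabla X Y Z
     - (1/2) *\<^sub>R ((D0 X Y - D0 Y X) \<odot> A \<diamondop> Z)
     - (1/2) *\<^sub>R (D0 X Z \<odot> A \<diamondop> Y) + (1/2) *\<^sub>R (D0 Y Z \<odot> A \<diamondop> X)
     + (1/4) *\<^sub>R ((\<pi> \<diamondop> Z) \<odot> ((\<pi> \<diamondop> Y) \<odot> X - (\<pi> \<diamondop> X) \<odot> Y))"

definition R1 :: "'a field \<Rightarrow> 'a field \<Rightarrow> 'a field \<Rightarrow> 'a field" where
  "R1 X Y Z = curvature M nabla X Y Z - D1 X Y \<odot> A \<diamondop> Z"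

definition R2 :: "'a field \<Rightarrow> 'a field \<Rightarrow> 'a field \<Rightarrow> 'a field" where
  "R2 X Y Z = curvature M nabla X Y Z - D2 X Z \<odot> A \<diamondop> Y + D2 Y Z \<odot> A \<diamondop> X"

definition R3 :: "'a field \<Rightarrow> 'a field \<Rightarrow> 'a field \<Rightarrow> 'a field" where
  "R3 X Y Z = curvature M nabla X Y Z - D2 X Y \<odot> A \<diamondop> Z + D3 Y Z \<odot> A \<diamondop> X"

definition R5 :: "'a field \<Rightarrow> 'a field \<Rightarrow> 'a field \<Rightarrow> 'a field" where
  "R5 X Y Z = curvature M nabla X Y Z
     - (1/2) *\<^sub>R ((D2 X Y - D3 Y X) \<odot> A \<diamondop> Z)
     - (1/2) *\<^sub>R (D3 X Z \<odot> A \<diamondop> Y) + (1/2) *\<^sub>R (D2 Y Z \<odot> A \<diamondop> X)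
     - (1/2) *\<^sub>R ((\<pi> \<diamondop> Y) \<odot> ((\<pi> \<diamondop> X) \<odot> Z - (\<pi> \<diamondop> Z) \<odot> X))"

definition H1 :: "'a field \<Rightarrow> 'a field \<Rightarrow> 'a field \<Rightarrow> 'a field" where
  "H1 X Y Z = R1 X Y Z + ricci M R1 Y (A \<diamondop> X) \<odot> A \<diamondop> Z"

definition H2 :: "'a field \<Rightarrow> 'a field \<Rightarrow> 'a field \<Rightarrow> 'a field" where
  "H2 X Y Z = R2 X Y Z
     + ricci M R2 (A \<diamondop> X) Z \<odot> A \<diamondop> Y - ricci M R2 (A \<diamondop> Y) Z \<odot> A \<diamondop> X"

definition H5 :: "'a field \<Rightarrow> 'a field \<Rightarrow> 'a field \<Rightarrow> 'a field" where
  "H5 X Y Z =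
     (let n = real CARD('n);
          Ric1 = ricci M R1; Ric3 = ricci M R3; Ric5 = ricci M R5; Ric3' = ricci' M R3
      in R5 X Y Z
       + (1 / (n - 1)) *\<^sub>R (Ric5 X Y \<odot> Z - Ric5 Y Z \<odot> X)
       - (1 / (2 * (n - 1))) *\<^sub>R (Ric1 X Y \<odot> Z - Ric1 Y Z \<odot> X)
       - (1 / (2 * (n - 1))) *\<^sub>R
           (Ric3' (A \<diamondop> Y) (A \<diamondop> X) \<odot> Z - Ric3' (A \<diamondop> Z) (A \<diamondop> Y) \<odot> X)
       + (1/2) *\<^sub>R
           (Ric1 Y (A \<diamondop> X) \<odot> A \<diamondop> Z - Ric3 Z (A \<diamondop> Y) \<odot> A \<diamondop> X - Ric3' (A \<diamondop> Z) X \<odot> A \<diamondop> Y))"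

definition H0 :: "'a field \<Rightarrow> 'a field \<Rightarrow> 'a field \<Rightarrow> 'a field" where
  "H0 X Y Z =
     (let n = real CARD('n);
          Ric0 = ricci M R0; Ric1 = ricci M R1; Ric3 = ricci M R3; Ric3' = ricci' M R3
      in R0 X Y Z
       + (1 / (n - 1)) *\<^sub>R (Ric0 X Z \<odot> Y - Ric0 Y Z \<odot> X)
       - (1 / (2 * (n - 1))) *\<^sub>R (Ric1 X Z \<odot> Y - Ric1 Y Z \<odot> X)
       - (1 / (4 * (n - 1))) *\<^sub>R
           (Ric3 Z X \<odot> Y - Ric3 Z Y \<odot> X
            + Ric3' (A \<diamondop> Z) (A \<diamondop> X) \<odot> Y - Ric3' (A \<diamondop> Z) (A \<diamondop> Y) \<odot> X)
       + (1/4) *\<^sub>R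
           (2 *\<^sub>R (Ric1 Y (A \<diamondop> X) \<odot> A \<diamondop> Z)
            + Ric3 Z (A \<diamondop> X) \<odot> A \<diamondop> Y - Ric3 Z (A \<diamondop> Y) \<odot> A \<diamondop> X)
       - (1/4) *\<^sub>R (Ric3' (A \<diamondop> Z) X \<odot> A \<diamondop> Y - Ric3' (A \<diamondop> Z) Y \<odot> A \<diamondop> X))"

end

end

end

theory Submission
  imports Defs
begin

text \<open>
  All tensors are compared at one point. Besides tensoriality, only three facts about the Levi-Civita
  connection enter: the first Bianchi identity, the vanishing of the trace of the \<open>g\<close>-skew
  endomorphism \<open>Z \<mapsto> R(X,Y)Z\<close>, and their consequence that \<open>Ric\<close> is symmetric. As \<open>A\<close> is \<open>g\<close>-skew
  with square \<open>-I\<close>, its trace vanishes as well, and the Ricci tensors of the other curvature tensors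
  differ from \<open>Ric\<close> by terms such as \<open>D(AY,Z)\<close>. The combinations in the \<open>H\<close> tensors are arranged so
  that the generator \<open>\<pi>\<close> cancels:
  \<open>H1(X,Y)Z = R(X,Y)Z + Ric(Y,AX)AZ\<close>, \<open>H2(X,Y)Z = R(X,Y)Z + Ric(AX,Z)AY - Ric(AY,Z)AX\<close>,
  \<open>4 H0(X,Y)Z = 4 R(X,Y)Z + 2 Ric(Y,AX)AZ + Ric(Z,AX)AY - Ric(Z,AY)AX
    + (Ric(X,Z)Y - Ric(Y,Z)X)/(n-1)\<close> and
  \<open>2 H5(X,Y)Z = 2 R(X,Y)Z + Ric(Y,AX)AZ - Ric(Z,AY)AX + (Ric(X,Y)Z - Ric(Y,Z)X)/(n-1)\<close>.
  The \<open>A\<close>-terms cancel by the symmetry of \<open>Ric\<close>, and the Bianchi identity gives the second relation.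
\<close>

section \<open>Functions of class \<open>C\<^sup>k\<close>\<close>

lemma Ck_on_subset: "Ck_on k T f \<Longrightarrow> S \<subseteq> T \<Longrightarrow> Ck_on k S f"
  by (induction k arbitrary: f) (auto intro: continuous_on_subset)

text \<open>At level \<open>Suc k\<close> the recursion asks only for differentiability and for the
  directional derivatives, not for level \<open>k\<close> itself. Nesting of the classes is
  therefore an induction, based on differentiability implying continuity.\<close>

lemma Ck_on_SucD: "Ck_on (Suc k) S f \<Longrightarrow> Ck_on k S f"
proof (induction k arbitrary: f)
  case 0
  then show ?case
    by (auto intro!: continuous_at_imp_continuous_on differentiable_imp_continuous_within)
next
  case (Suc k)
  then show ?case
    using Ck_on.simps(2)[of "Suc k" S f] Ck_on.simps(2)[of k S f] by blast
qed

lemma frechet_derivative_cong_open: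
  assumes "open S" "x \<in> S" "\<And>y. y \<in> S \<Longrightarrow> f y = g y"
  shows "frechet_derivative f (at x) = frechet_derivative g (at x)"
proof -
  \<comment> \<open>\<open>frechet_derivative\<close> is a choice among the maps satisfying
    \<open>has_derivative\<close>. Equivalent predicates yield the same choice, even where no
    derivative exists.\<close>
  have "(f has_derivative D) (at x) \<longleftrightarrow> (g has_derivative D) (at x)" for D
    using assms has_derivative_transform_within_open by metis
  then show ?thesis
    by (simp add: frechet_derivative_def)
qed

text \<open>Coordinate expressions such as \<open>f \<circ> inv_into U \<phi>\<close> are known only
  on chart images. Openness of \<open>S\<close> makes derivatives at its points blind to the values
  outside.\<close>

lemma Ck_on_cong:
  assumes "open S" "\<And>y. y \<in> S \<Longrightarrow> f y = g y" "Ck_on k S f"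
  shows "Ck_on k S g"
  using assms(2,3)
proof (induction k arbitrary: f g)
  case 0
  then show ?case by (simp cong: continuous_on_cong)
next
  case (Suc k)
  have "g differentiable (at x)" if "x \<in> S" for x
    using Suc.prems that has_derivative_transform_within_open[OF _ assms(1) that, of f _ UNIV g]
    unfolding differentiable_def Ck_on.simps(2) by blast
  moreover have "Ck_on k S (\<lambda>x. frechet_derivative g (at x) v)" for v
    using Suc.IH[of "\<lambda>x. frechet_derivative f (at x) v" "\<lambda>x. frechet_derivative g (at x) v"]
      frechet_derivative_cong_open[OF assms(1), of _ f g] Suc.prems by simp
  ultimately show ?case by simp
qed

lemma Ck_on_const: "Ck_on k S (\<lambda>_. c)"
  by (induction k arbitrary: c) auto

text \<open>The pattern of all closure proofs below: compute the derivative on \<open>S\<close>,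
  observe that it is built from functions of class \<open>k\<close>, and transfer the class to
  \<open>frechet_derivative\<close> by \<open>Ck_on_cong\<close>.\<close>

lemma Ck_on_linear:
  assumes "bounded_linear L" "open S" "Ck_on k S f"
  shows "Ck_on k S (\<lambda>x. L (f x))"
  using assms(3)
proof (induction k arbitrary: f)
  case 0
  then show ?case
    using assms(1) by (simp add: bounded_linear.continuous_on)
next
  case (Suc k)
  have D: "((\<lambda>x. L (f x)) has_derivative (\<lambda>v. L (frechet_derivative f (at x) v))) (at x)"
    if "x \<in> S" for x
    using Suc.prems that assms(1)
    by (simp add: bounded_linear.has_derivative frechet_derivative_works)
  have "Ck_on k S (\<lambda>x. frechet_derivative (\<lambda>x. L (f x)) (at x) v)" for v
    by (rule Ck_on_cong[OF assms(2) _ Suc.IH[of "\<lambda>x. frechet_derivative f (at x) v"]])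
      (use Suc.prems in \<open>simp_all add: frechet_derivative_at[OF D, symmetric]\<close>)
  with D show ?case by (auto simp: differentiable_def)
qed

lemma Ck_on_add:
  assumes "open S" "Ck_on k S f" "Ck_on k S g"
  shows "Ck_on k S (\<lambda>x. f x + g x)"
  using assms(2,3)
proof (induction k arbitrary: f g)
  case 0
  then show ?case by (simp add: continuous_on_add)
next
  case (Suc k)
  have D: "((\<lambda>x. f x + g x) has_derivative
      (\<lambda>v. frechet_derivative f (at x) v + frechet_derivative g (at x) v)) (at x)"
    if "x \<in> S" for x
    using Suc.prems that by (auto intro!: has_derivative_add simp: frechet_derivative_works)
  have "Ck_on k S (\<lambda>x. frechet_derivative (\<lambda>x. f x + g x) (at x) v)" for v
    by (rule Ck_on_cong[OF assms(1) _ Suc.IH[of "\<lambda>x. frechet_derivative f (at x) v"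
            "\<lambda>x. frechet_derivative g (at x) v"]])
      (use Suc.prems in \<open>simp_all add: frechet_derivative_at[OF D, symmetric]\<close>)
  with D show ?case by (auto simp: differentiable_def)
qed

lemma Ck_on_sum:
  assumes "open S" "\<And>i. i \<in> I \<Longrightarrow> Ck_on k S (f i)"
  shows "Ck_on k S (\<lambda>x. \<Sum>i\<in>I. f i x)"
  using assms(2)
  by (induction I rule: infinite_finite_induct) (auto intro: Ck_on_const Ck_on_add[OF assms(1)])

lemma Ck_on_scaleR:
  assumes "open S" "Ck_on k S h" "Ck_on k S f"
  shows "Ck_on k S (\<lambda>x. h x *\<^sub>R f x)"
  using assms(2,3)
proof (induction k arbitrary: f h)
  case 0
  then show ?case by (simp add: continuous_on_scaleR)
next
  case (Suc k)
  have D: "((\<lambda>x. h x *\<^sub>R f x) has_derivative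
      (\<lambda>v. h x *\<^sub>R frechet_derivative f (at x) v + frechet_derivative h (at x) v *\<^sub>R f x)) (at x)"
    if "x \<in> S" for x
    using Suc.prems that by (auto intro!: has_derivative_scaleR simp: frechet_derivative_works)
  \<comment> \<open>The product rule keeps undifferentiated factors, whose class has to be lowered
    before the induction hypothesis applies.\<close>
  have "Ck_on k S (\<lambda>x. h x *\<^sub>R frechet_derivative f (at x) v + frechet_derivative h (at x) v *\<^sub>R f x)"
    for v
    using Suc.prems Ck_on_SucD[OF Suc.prems(1)] Ck_on_SucD[OF Suc.prems(2)]
    by (intro Ck_on_add[OF assms(1)] Suc.IH) auto
  then have "Ck_on k S (\<lambda>x. frechet_derivative (\<lambda>x. h x *\<^sub>R f x) (at x) v)" for v
    by (rule Ck_on_cong[OF assms(1), rotated]) (simp add: frechet_derivative_at[OF D, symmetric])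
  with D show ?case by (auto simp: differentiable_def)
qed

lemma Ck_on_compose:
  assumes "open S" "open T" "g ` S \<subseteq> T" "Ck_on k S g" "Ck_on k T f"
  shows "Ck_on k S (f \<circ> g)"
  using assms(4,5)
proof (induction k arbitrary: f)
  case 0
  then show ?case using assms(3) by (auto simp: o_def intro: continuous_on_compose2)
next
  case (Suc k)
  \<comment> \<open>The chain rule differentiates \<open>f\<close> in the direction of the
    derivative of \<open>g\<close>, which moves with \<open>x\<close>, whereas \<open>Ck_on\<close>
    speaks of fixed directions. Expansion in the basis leaves fixed directions with coefficients of
    class \<open>k\<close>.\<close>
  let ?D = "\<lambda>v x. \<Sum>b\<in>Basis. (frechet_derivative g (at x) v \<bullet> b) *\<^sub>R frechet_derivative f (at (g x)) b"
  have D: "((f \<circ> g) has_derivative (\<lambda>v. ?D v x)) (at x)" if "x \<in> S" for x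
  proof -
    have f: "(f has_derivative frechet_derivative f (at (g x))) (at (g x))"
      and g: "(g has_derivative frechet_derivative g (at x)) (at x)"
      using Suc.prems assms(3) that by (auto simp: frechet_derivative_works)
    have lin: "linear (frechet_derivative f (at (g x)))"
      using f has_derivative_linear by blast
    have "frechet_derivative f (at (g x)) (frechet_derivative g (at x) v) = ?D v x" for v
      by (subst euclidean_representation[of "frechet_derivative g (at x) v", symmetric])
        (simp add: linear_sum[OF lin] linear_cmul[OF lin] del: euclidean_representation)
    then show ?thesis
      using diff_chain_at[OF g f] by (simp add: o_def)
  qed
  have "Ck_on k S (?D v)" for v
  proof (intro Ck_on_sum[OF assms(1)] Ck_on_scaleR[OF assms(1)])
    fix b :: 'b
    show "Ck_on k S (\<lambda>x. frechet_derivative g (at x) v \<bullet> b)"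
      using Suc.prems by (intro Ck_on_linear[OF bounded_linear_inner_left assms(1)]) simp
    show "Ck_on k S (\<lambda>x. frechet_derivative f (at (g x)) b)"
      using Suc.IH[of "\<lambda>y. frechet_derivative f (at y) b"] Suc.prems Ck_on_SucD[of k S g]
      by (simp add: o_def)
  qed
  then have "Ck_on k S (\<lambda>x. frechet_derivative (f \<circ> g) (at x) v)" for v
    by (rule Ck_on_cong[OF assms(1), rotated]) (simp add: frechet_derivative_at[OF D, symmetric])
  with D show ?case by (auto simp: o_def differentiable_def)
qed

lemma smooth_on_cong: "smooth_on S f \<Longrightarrow> open S \<Longrightarrow> (\<And>y. y \<in> S \<Longrightarrow> f y = g y) \<Longrightarrow> smooth_on S g"
  by (metis smooth_on_def Ck_on_cong)

lemma smooth_on_subset: "smooth_on T f \<Longrightarrow> S \<subseteq> T \<Longrightarrow> smooth_on S f"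
  by (metis smooth_on_def Ck_on_subset)

lemma smooth_on_differentiable: "smooth_on S f \<Longrightarrow> x \<in> S \<Longrightarrow> f differentiable (at x)"
  unfolding smooth_on_def using Ck_on.simps(2)[of _ S f] by blast

lemma smooth_on_frechet_derivative:
  "smooth_on S f \<Longrightarrow> smooth_on S (\<lambda>x. frechet_derivative f (at x) v)"
  unfolding smooth_on_def using Ck_on.simps(2)[of _ S f] by blast

lemma smooth_on_compose:
  "smooth_on T f \<Longrightarrow> smooth_on S g \<Longrightarrow> open S \<Longrightarrow> open T \<Longrightarrow> g ` S \<subseteq> T \<Longrightarrow> smooth_on S (f \<circ> g)"
  by (simp add: smooth_on_def Ck_on_compose)

section \<open>Charts and tangent spaces\<close>

lemma sum_fun_apply: "(\<Sum>i\<in>I. f i) x = (\<Sum>i\<in>I. f i x)"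
  by (induction I rule: infinite_finite_induct) auto

lemma scaleR_fun_apply [simp]: "(c *\<^sub>R f) x = c *\<^sub>R f x"
  by (simp add: scaleR_fun_def)

section \<open>Charts of a smooth manifold\<close>

locale manifold =
  fixes M :: "('a, 'n::finite) atlas_space"
  assumes M: "smooth_manifold M"
begin

lemma chart_openin: "(U, \<phi>) \<in> charts M \<Longrightarrow> openin (mtop M) U"
  and chart_homeomorphic:
    "(U, \<phi>) \<in> charts M \<Longrightarrow> homeomorphic_map (subtopology (mtop M) U) (top_of_set (\<phi> ` U)) \<phi>"
  and chart_open_range: "(U, \<phi>) \<in> charts M \<Longrightarrow> open (\<phi> ` U)"
  using M by (auto simp: smooth_manifold_def)

lemma chart_transition:
  "(U, \<phi>) \<in> charts M \<Longrightarrow> (V, \<psi>) \<in> charts M \<Longrightarrow> smooth_on (\<phi> ` (U \<inter> V)) (\<psi> \<circ> inv_into U \<phi>)"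
  using M by (fastforce simp: smooth_manifold_def)

lemma chart_exists: "p \<in> topspace (mtop M) \<Longrightarrow> \<exists>c. c \<in> charts M \<and> p \<in> fst c"
  using M unfolding smooth_manifold_def by force

lemma chart_inj_on:
  assumes "(U, \<phi>) \<in> charts M"
  shows "inj_on \<phi> U"
  using homeomorphic_imp_injective_map[OF chart_homeomorphic[OF assms]]
    openin_subset[OF chart_openin[OF assms]]
  by (simp add: Int_absorb1)

lemma chart_open_image:
  assumes "(U, \<phi>) \<in> charts M" "openin (mtop M) W"
  shows "open (\<phi> ` (U \<inter> W))"
proof -
  have "openin (subtopology (mtop M) U) (U \<inter> W)"
    using assms(2) by (metis Int_commute openin_subtopology_Int)
  then have "openin (top_of_set (\<phi> ` U)) (\<phi> ` (U \<inter> W))"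
    using homeomorphic_imp_open_map[OF chart_homeomorphic[OF assms(1)]] by (auto simp: open_map_def)
  then show ?thesis
    using chart_open_range[OF assms(1)] openin_open_trans by blast
qed

section \<open>Smooth functions on open sets\<close>

lemma smooth_fun_on_openin: "smooth_fun_on M W f \<Longrightarrow> openin (mtop M) W"
  by (simp add: smooth_fun_on_def)

lemma smooth_fun_on_chart:
  "smooth_fun_on M W f \<Longrightarrow> (U, \<phi>) \<in> charts M \<Longrightarrow> smooth_on (\<phi> ` (U \<inter> W)) (f \<circ> inv_into U \<phi>)"
  by (auto simp: smooth_fun_on_def)

lemma smooth_fun_on_cong:
  assumes "smooth_fun_on M W f" "\<And>q. q \<in> W \<Longrightarrow> f q = h q"
  shows "smooth_fun_on M W h"
  unfolding smooth_fun_on_def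
proof (safe)
  show W: "openin (mtop M) W" using assms(1) smooth_fun_on_openin by blast
  fix U \<phi> assume c: "(U, \<phi>) \<in> charts M"
  show "smooth_on (\<phi> ` (U \<inter> W)) (h \<circ> inv_into U \<phi>)"
    by (rule smooth_on_cong[OF smooth_fun_on_chart[OF assms(1) c] chart_open_image[OF c W]])
      (use assms(2) chart_inj_on[OF c] in auto)
qed

lemma smooth_fun_on_subset:
  assumes "smooth_fun_on M W f" "openin (mtop M) V" "V \<subseteq> W"
  shows "smooth_fun_on M V f"
  unfolding smooth_fun_on_def
proof (safe)
  fix U \<phi> assume c: "(U, \<phi>) \<in> charts M"
  show "smooth_on (\<phi> ` (U \<inter> V)) (f \<circ> inv_into U \<phi>)"
    by (rule smooth_on_subset[OF smooth_fun_on_chart[OF assms(1) c]]) (use assms(3) in auto)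
qed (rule assms)

lemma smooth_fun_on_const: "openin (mtop M) W \<Longrightarrow> smooth_fun_on M W (\<lambda>_. c)"
  by (auto simp: smooth_fun_on_def smooth_on_def o_def Ck_on_const)

lemma smooth_fun_on_add:
  assumes "smooth_fun_on M W f" "smooth_fun_on M W h"
  shows "smooth_fun_on M W (\<lambda>q. f q + h q)"
  using assms chart_open_image by (auto simp: smooth_fun_on_def smooth_on_def o_def intro!: Ck_on_add)

lemma smooth_fun_on_mult:
  assumes "smooth_fun_on M W f" "smooth_fun_on M W h"
  shows "smooth_fun_on M W (\<lambda>q. f q * h q)"
  using assms chart_open_image
  by (auto simp: smooth_fun_on_def smooth_on_def o_def intro!: Ck_on_scaleR[where 'a = real, simplified]
      Ck_on_scaleR[where f = "f :: _ \<Rightarrow> real" for f, simplified])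

lemma smooth_fun_on_cmult: "smooth_fun_on M W f \<Longrightarrow> smooth_fun_on M W (\<lambda>q. c * f q)"
  using smooth_fun_on_mult[OF smooth_fun_on_const] smooth_fun_on_openin by blast

lemma smooth_fun_on_diff:
  assumes "smooth_fun_on M W f" "smooth_fun_on M W h"
  shows "smooth_fun_on M W (\<lambda>q. f q - h q)"
  using smooth_fun_on_add[OF assms(1) smooth_fun_on_cmult[OF assms(2), of "-1"]] by simp

text \<open>Any other coordinate expression of \<open>f\<close> is this one composed with a
  transition map, which is smooth.\<close>

lemma smooth_fun_on_chartI:
  assumes c: "(U, \<phi>) \<in> charts M" and W: "W \<subseteq> U" "openin (mtop M) W"
    and f: "smooth_on (\<phi> ` W) (f \<circ> inv_into U \<phi>)"
  shows "smooth_fun_on M W f"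
  unfolding smooth_fun_on_def
proof (safe)
  fix V \<psi> assume d: "(V, \<psi>) \<in> charts M"
  have "smooth_on (\<psi> ` (V \<inter> W)) ((f \<circ> inv_into U \<phi>) \<circ> (\<phi> \<circ> inv_into V \<psi>))"
  proof (rule smooth_on_compose[OF f])
    show "smooth_on (\<psi> ` (V \<inter> W)) (\<phi> \<circ> inv_into V \<psi>)"
      by (rule smooth_on_subset[OF chart_transition[OF d c]]) (use W in auto)
    show "open (\<psi> ` (V \<inter> W))" using chart_open_image[OF d W(2)] .
    show "open (\<phi> ` W)" using chart_open_image[OF c W(2)] W(1) by (simp add: Int_absorb1)
    show "(\<phi> \<circ> inv_into V \<psi>) ` \<psi> ` (V \<inter> W) \<subseteq> \<phi> ` W"
      using chart_inj_on[OF d] by auto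
  qed
  then show "smooth_on (\<psi> ` (V \<inter> W)) (f \<circ> inv_into V \<psi>)"
    by (rule smooth_on_cong[OF _ chart_open_image[OF d W(2)]])
      (use W chart_inj_on[OF d] chart_inj_on[OF c] in auto)
qed (rule W)

lemma smooth_fun_on_coordinate:
  assumes c: "(U, \<phi>) \<in> charts M"
  shows "smooth_fun_on M U (\<lambda>q. \<phi> q $ i)"
proof (rule smooth_fun_on_chartI[OF c order.refl chart_openin[OF c]])
  have "smooth_on (\<phi> ` U) (\<phi> \<circ> inv_into U \<phi>)"
    using chart_transition[OF c c] by simp
  then show "smooth_on (\<phi> ` U) ((\<lambda>q. \<phi> q $ i) \<circ> inv_into U \<phi>)"
    using Ck_on_linear[OF bounded_linear_vec_nth chart_open_range[OF c]]
    by (auto simp: smooth_on_def o_def)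
qed

section \<open>Functions smooth near a point\<close>

lemma smooth_nearI: "smooth_fun_on M W f \<Longrightarrow> p \<in> W \<Longrightarrow> smooth_near M p f"
  by (auto simp: smooth_near_def)

text \<open>Tangent vectors vanish by convention on functions that are not smooth near
  \<open>p\<close>. They can be local only if this smoothness test is local.\<close>

lemma smooth_near_cong:
  assumes "openin (mtop M) W" "p \<in> W" "\<And>q. q \<in> W \<Longrightarrow> f q = h q"
  shows "smooth_near M p f = smooth_near M p h"
proof -
  have *: "smooth_near M p h" if "smooth_near M p f" "\<And>q. q \<in> W \<Longrightarrow> f q = h q" for f h
  proof -
    from that obtain V where "p \<in> V" "smooth_fun_on M V f" by (auto simp: smooth_near_def)
    then have "smooth_fun_on M (V \<inter> W) f"
      using smooth_fun_on_subset smooth_fun_on_openin assms(1) by blast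
    then have "smooth_fun_on M (V \<inter> W) h"
      by (rule smooth_fun_on_cong) (use that in auto)
    then show ?thesis using \<open>p \<in> V\<close> assms(2) by (auto intro: smooth_nearI)
  qed
  show ?thesis using *[of f h] *[of h f] assms(3) by force
qed

lemma smooth_near_common:
  assumes "smooth_near M p f" "smooth_near M p h"
  obtains W where "p \<in> W" "smooth_fun_on M W f" "smooth_fun_on M W h"
proof -
  from assms obtain V W where "p \<in> V" "smooth_fun_on M V f" "p \<in> W" "smooth_fun_on M W h"
    by (auto simp: smooth_near_def)
  then show ?thesis
    using that[of "V \<inter> W"] smooth_fun_on_subset smooth_fun_on_openin by blast
qed

lemma smooth_near_add: "smooth_near M p f \<Longrightarrow> smooth_near M p h \<Longrightarrow> smooth_near M p (\<lambda>q. f q + h q)"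
  and smooth_near_mult: "smooth_near M p f \<Longrightarrow> smooth_near M p h \<Longrightarrow> smooth_near M p (\<lambda>q. f q * h q)"
  by (metis smooth_near_common smooth_fun_on_add smooth_nearI)
    (metis smooth_near_common smooth_fun_on_mult smooth_nearI)

section \<open>Coordinate derivatives and the tangent space\<close>

lemma smooth_near_has_derivative:
  assumes c: "(U, \<phi>) \<in> charts M" and p: "p \<in> U" and f: "smooth_near M p f"
  shows "((f \<circ> inv_into U \<phi>) has_derivative (\<lambda>w. chart_deriv M (U, \<phi>) w p f)) (at (\<phi> p))"
proof -
  from f obtain W where W: "p \<in> W" "smooth_fun_on M W f" by (auto simp: smooth_near_def)
  then have "(f \<circ> inv_into U \<phi>) differentiable (at (\<phi> p))"
    using smooth_on_differentiable[OF smooth_fun_on_chart[OF W(2) c]] p by blast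
  then show ?thesis
    using f by (simp add: chart_deriv_def frechet_derivative_works)
qed

lemma chart_deriv_eqI:
  assumes "smooth_near M p f" "((f \<circ> inv_into U \<phi>) has_derivative D) (at (\<phi> p))"
  shows "chart_deriv M (U, \<phi>) w p f = D w"
  using assms frechet_derivative_at[OF assms(2)] by (simp add: chart_deriv_def)

lemma chart_deriv_not_smooth: "\<not> smooth_near M p f \<Longrightarrow> chart_deriv M c w p f = 0"
  by (cases c) (simp add: chart_deriv_def)

lemma chart_deriv_linear:
  assumes c: "(U, \<phi>) \<in> charts M" and p: "p \<in> U"
  shows "linear (\<lambda>w. chart_deriv M (U, \<phi>) w p)"
proof -
  have lin: "linear (\<lambda>w. chart_deriv M (U, \<phi>) w p f)" for f
    using smooth_near_has_derivative[OF c p] has_derivative_linear chart_deriv_not_smooth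
    by (cases "smooth_near M p f") (auto intro: linearI)
  then show ?thesis
    by (intro linearI ext) (simp_all add: linear_add[OF lin] linear_cmul[OF lin])
qed

text \<open>Chain rule: the components of a tangent vector transform by the Jacobian of the
  transition map. On functions that are not smooth near \<open>p\<close> both sides are 0 by
  convention.\<close>

lemma chart_deriv_change:
  assumes c: "(U, \<phi>) \<in> charts M" and d: "(V, \<psi>) \<in> charts M" and p: "p \<in> U" "p \<in> V"
  shows "chart_deriv M (V, \<psi>) w p =
    chart_deriv M (U, \<phi>) (frechet_derivative (\<phi> \<circ> inv_into V \<psi>) (at (\<psi> p)) w) p"
proof
  fix f
  let ?T = "\<phi> \<circ> inv_into V \<psi>"
  show "chart_deriv M (V, \<psi>) w p f = chart_deriv M (U, \<phi>) (frechet_derivative ?T (at (\<psi> p)) w) p f"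
  proof (cases "smooth_near M p f")
    case True
    have T: "(?T has_derivative frechet_derivative ?T (at (\<psi> p))) (at (\<psi> p))"
      using smooth_on_differentiable[OF chart_transition[OF d c]] p
      by (simp add: frechet_derivative_works)
    have "?T (\<psi> p) = \<phi> p" using chart_inj_on[OF d] p by simp
    then have D: "((f \<circ> inv_into U \<phi> \<circ> ?T) has_derivative
        (\<lambda>w. chart_deriv M (U, \<phi>) w p f) \<circ> frechet_derivative ?T (at (\<psi> p))) (at (\<psi> p))"
      using diff_chain_at[OF T] smooth_near_has_derivative[OF c p(1) True] by simp
    have "((f \<circ> inv_into V \<psi>) has_derivative
        (\<lambda>w. chart_deriv M (U, \<phi>) w p f) \<circ> frechet_derivative ?T (at (\<psi> p))) (at (\<psi> p))"
      by (rule has_derivative_transform_within_open[OF D chart_open_image[OF d chart_openin[OF c]]])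
        (use p chart_inj_on[OF d] chart_inj_on[OF c] in auto)
    then show ?thesis
      by (simp add: chart_deriv_eqI[OF True])
  qed (simp add: chart_deriv_not_smooth)
qed

text \<open>\<open>tangent_space\<close> collects derivatives from all charts around
  \<open>p\<close>. The change of charts shows that a single one yields them all, so the tangent
  space is a linear image of the coordinate space.\<close>

lemma tangent_space_chart:
  assumes c: "(U, \<phi>) \<in> charts M" and p: "p \<in> U"
  shows "tangent_space M p = range (\<lambda>w. chart_deriv M (U, \<phi>) w p)"
proof
  show "tangent_space M p \<subseteq> range (\<lambda>w. chart_deriv M (U, \<phi>) w p)"
  proof
    fix v assume "v \<in> tangent_space M p"
    then obtain V \<psi> w where "(V, \<psi>) \<in> charts M" "p \<in> V" "v = chart_deriv M (V, \<psi>) w p"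
      unfolding tangent_space_def by auto
    then show "v \<in> range (\<lambda>w. chart_deriv M (U, \<phi>) w p)"
      using chart_deriv_change[OF c _ p] by blast
  qed
  show "range (\<lambda>w. chart_deriv M (U, \<phi>) w p) \<subseteq> tangent_space M p"
    unfolding tangent_space_def using assms by force
qed

lemma tangent_subspace:
  assumes "p \<in> topspace (mtop M)"
  shows "subspace (tangent_space M p)"
proof -
  obtain U \<phi> where c: "(U, \<phi>) \<in> charts M" "p \<in> U" using chart_exists[OF assms] by auto
  show ?thesis
    unfolding tangent_space_chart[OF c]
    by (rule linear_subspace_image[OF chart_deriv_linear[OF c] subspace_UNIV])
qed

lemma chart_deriv_coordinate:
  assumes c: "(U, \<phi>) \<in> charts M" and p: "p \<in> U"
  shows "chart_deriv M (U, \<phi>) w p (\<lambda>q. \<phi> q $ i) = w $ i"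
proof -
  have "((\<lambda>x. x $ i) has_derivative (\<lambda>x. x $ i)) (at (\<phi> p))"
    by (rule bounded_linear_imp_has_derivative[OF bounded_linear_vec_nth])
  then have "(((\<lambda>q. \<phi> q $ i) \<circ> inv_into U \<phi>) has_derivative (\<lambda>x. x $ i)) (at (\<phi> p))"
    by (rule has_derivative_transform_within_open[OF _ chart_open_range[OF c]])
      (use p in \<open>auto simp: f_inv_into_f\<close>)
  then show ?thesis
    using chart_deriv_eqI smooth_nearI[OF smooth_fun_on_coordinate[OF c] p] by blast
qed

lemma tangent_expand:
  assumes c: "(U, \<phi>) \<in> charts M" and p: "p \<in> U" and v: "v \<in> tangent_space M p"
  shows "v = (\<Sum>i\<in>UNIV. v (\<lambda>q. \<phi> q $ i) *\<^sub>R chart_deriv M (U, \<phi>) (axis i 1) p)"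
proof -
  obtain w where w: "v = chart_deriv M (U, \<phi>) w p"
    using v tangent_space_chart[OF c p] by auto
  have "w = (\<Sum>i\<in>UNIV. w $ i *\<^sub>R axis i 1)"
    using basis_expansion[of w] by (simp add: scalar_mult_eq_scaleR)
  then have "v = chart_deriv M (U, \<phi>) (\<Sum>i\<in>UNIV. w $ i *\<^sub>R axis i 1) p"
    using w by simp
  also have "\<dots> = (\<Sum>i\<in>UNIV. w $ i *\<^sub>R chart_deriv M (U, \<phi>) (axis i 1) p)"
    by (simp add: linear_sum[OF chart_deriv_linear[OF c p]] linear_cmul[OF chart_deriv_linear[OF c p]])
  finally show ?thesis
    unfolding w chart_deriv_coordinate[OF c p] .
qed

section \<open>Tangent vectors as local derivations\<close>

lemma tangent_cong:
  assumes "v \<in> tangent_space M p" "openin (mtop M) W" "p \<in> W" "\<And>q. q \<in> W \<Longrightarrow> f q = h q"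
  shows "v f = v h"
proof -
  from assms(1) obtain U \<phi> w where c: "(U, \<phi>) \<in> charts M" "p \<in> U" and v: "v = chart_deriv M (U, \<phi>) w p"
    by (auto simp: tangent_space_def)
  have sm: "smooth_near M p f = smooth_near M p h"
    using smooth_near_cong[OF assms(2,3,4)] .
  have "frechet_derivative (f \<circ> inv_into U \<phi>) (at (\<phi> p)) =
      frechet_derivative (h \<circ> inv_into U \<phi>) (at (\<phi> p))"
    by (rule frechet_derivative_cong_open[OF chart_open_image[OF c(1) assms(2)]])
      (use assms c chart_inj_on[OF c(1)] in auto)
  then show ?thesis by (simp add: v sm chart_deriv_def)
qed

lemma tangent_add:
  assumes "v \<in> tangent_space M p" "smooth_near M p f" "smooth_near M p h"
  shows "v (\<lambda>q. f q + h q) = v f + v h"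
proof -
  from assms(1) obtain U \<phi> w where c: "(U, \<phi>) \<in> charts M" "p \<in> U" and v: "v = chart_deriv M (U, \<phi>) w p"
    by (auto simp: tangent_space_def)
  from has_derivative_add[OF smooth_near_has_derivative[OF c assms(2)] smooth_near_has_derivative[OF c assms(3)]]
  have "((\<lambda>q. f q + h q) \<circ> inv_into U \<phi> has_derivative
      (\<lambda>w. chart_deriv M (U, \<phi>) w p f + chart_deriv M (U, \<phi>) w p h)) (at (\<phi> p))"
    by (simp add: o_def)
  from chart_deriv_eqI[OF smooth_near_add[OF assms(2,3)] this] show ?thesis by (simp add: v)
qed

lemma tangent_mult:
  assumes "v \<in> tangent_space M p" "smooth_near M p f" "smooth_near M p h"
  shows "v (\<lambda>q. f q * h q) = f p * v h + v f * h p"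
proof -
  from assms(1) obtain U \<phi> w where c: "(U, \<phi>) \<in> charts M" "p \<in> U" and v: "v = chart_deriv M (U, \<phi>) w p"
    by (auto simp: tangent_space_def)
  from has_derivative_mult[OF smooth_near_has_derivative[OF c assms(2)] smooth_near_has_derivative[OF c assms(3)]]
  have "((\<lambda>q. f q * h q) \<circ> inv_into U \<phi> has_derivative
      (\<lambda>w. f p * chart_deriv M (U, \<phi>) w p h + chart_deriv M (U, \<phi>) w p f * h p)) (at (\<phi> p))"
    using chart_inj_on[OF c(1)] c(2) by (simp add: o_def)
  from chart_deriv_eqI[OF smooth_near_mult[OF assms(2,3)] this] show ?thesis by (simp add: v)
qed

lemma tangent_diff:
  assumes "v \<in> tangent_space M p" "smooth_near M p f" "smooth_near M p h"
  shows "v (\<lambda>q. f q - h q) = v f - v h"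
proof -
  obtain W where W: "p \<in> W" "smooth_fun_on M W f" "smooth_fun_on M W h"
    using smooth_near_common[OF assms(2,3)] .
  have "v (\<lambda>q. (f q - h q) + h q) = v (\<lambda>q. f q - h q) + v h"
    using smooth_nearI[OF smooth_fun_on_diff[OF W(2,3)] W(1)] assms by (intro tangent_add)
  then show ?thesis by simp
qed

end

section \<open>Vector fields and the Lie bracket\<close>

context manifold
begin

section \<open>Vector fields over open sets\<close>

lemma vector_field_on_openin: "vector_field_on M W X \<Longrightarrow> openin (mtop M) W"
  and vector_field_on_tangent: "vector_field_on M W X \<Longrightarrow> p \<in> W \<Longrightarrow> X p \<in> tangent_space M p"
  and vector_field_on_smooth:
    "vector_field_on M W X \<Longrightarrow> smooth_fun_on M V f \<Longrightarrow> V \<subseteq> W \<Longrightarrow> smooth_fun_on M V (\<lambda>p. X p f)"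
  by (auto simp: vector_field_on_def)

lemma vector_field_on_subset:
  "vector_field_on M W X \<Longrightarrow> openin (mtop M) V \<Longrightarrow> V \<subseteq> W \<Longrightarrow> vector_field_on M V X"
  unfolding vector_field_on_def by blast

lemma openin_topspace_mem: "openin (mtop M) W \<Longrightarrow> p \<in> W \<Longrightarrow> p \<in> topspace (mtop M)"
  using openin_subset by blast

lemma vector_field_on_cong:
  assumes "vector_field_on M W X" "\<And>q. q \<in> W \<Longrightarrow> X q = Y q"
  shows "vector_field_on M W Y"
  unfolding vector_field_on_def
proof (safe)
  show "openin (mtop M) W" using assms(1) vector_field_on_openin by blast
  show "Y p \<in> tangent_space M p" if "p \<in> W" for p
    using vector_field_on_tangent[OF assms(1) that] assms(2)[OF that] by simp
  show "smooth_fun_on M V (\<lambda>p. Y p f)" if "V \<subseteq> W" "smooth_fun_on M V f" for V f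
    by (rule smooth_fun_on_cong[OF vector_field_on_smooth[OF assms(1) that(2,1)]])
      (use assms(2) that in auto)
qed

lemma vector_field_on_add:
  assumes "vector_field_on M W X" "vector_field_on M W Y"
  shows "vector_field_on M W (X + Y)"
  unfolding vector_field_on_def
proof (safe)
  show W: "openin (mtop M) W" using assms(1) vector_field_on_openin by blast
  show "(X + Y) p \<in> tangent_space M p" if "p \<in> W" for p
    using subspace_add[OF tangent_subspace] openin_topspace_mem[OF W that]
      vector_field_on_tangent[OF assms(1) that] vector_field_on_tangent[OF assms(2) that] by simp
  show "smooth_fun_on M V (\<lambda>p. (X + Y) p f)" if "V \<subseteq> W" "smooth_fun_on M V f" for V f
    using smooth_fun_on_add vector_field_on_smooth[OF assms(1) that(2,1)]
      vector_field_on_smooth[OF assms(2) that(2,1)] by simp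
qed

lemma vector_field_on_fscale:
  assumes "smooth_fun_on M W h" "vector_field_on M W X"
  shows "vector_field_on M W (h \<odot> X)"
  unfolding vector_field_on_def
proof (safe)
  show W: "openin (mtop M) W" using assms(2) vector_field_on_openin by blast
  show "(h \<odot> X) p \<in> tangent_space M p" if "p \<in> W" for p
    using subspace_scale[OF tangent_subspace] openin_topspace_mem[OF W that]
      vector_field_on_tangent[OF assms(2) that] by (simp add: fscale_def)
  show "smooth_fun_on M V (\<lambda>p. (h \<odot> X) p f)" if "V \<subseteq> W" "smooth_fun_on M V f" for V f
    using smooth_fun_on_mult[OF smooth_fun_on_subset[OF assms(1) smooth_fun_on_openin[OF that(2)] that(1)]
        vector_field_on_smooth[OF assms(2) that(2,1)]]
    by (simp add: fscale_def)
qed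

lemma vector_field_on_uminus:
  assumes "vector_field_on M W X"
  shows "vector_field_on M W (- X)"
  by (rule vector_field_on_cong[OF vector_field_on_fscale[OF
          smooth_fun_on_const[OF vector_field_on_openin[OF assms], of "-1"] assms]])
    (simp add: fscale_def)

lemma vector_field_on_diff:
  "vector_field_on M W X \<Longrightarrow> vector_field_on M W Y \<Longrightarrow> vector_field_on M W (X - Y)"
  using vector_field_on_add[of W X "- Y"] vector_field_on_uminus by simp

lemma vector_field_on_coordinate:
  assumes c: "(U, \<phi>) \<in> charts M"
  shows "vector_field_on M U (chart_deriv M (U, \<phi>) w)"
  unfolding vector_field_on_def
proof (safe)
  show "openin (mtop M) U" using chart_openin[OF c] .
  show "chart_deriv M (U, \<phi>) w p \<in> tangent_space M p" if "p \<in> U" for p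
    using tangent_space_chart[OF c that] by blast
  fix V f assume V: "V \<subseteq> U" and f: "smooth_fun_on M V f"
  have VU: "U \<inter> V = V" using V by auto
  show "smooth_fun_on M V (\<lambda>p. chart_deriv M (U, \<phi>) w p f)"
  proof (rule smooth_fun_on_chartI[OF c V smooth_fun_on_openin[OF f]])
    have "smooth_on (\<phi> ` V) (\<lambda>x. frechet_derivative (f \<circ> inv_into U \<phi>) (at x) w)"
      using smooth_on_frechet_derivative[OF smooth_fun_on_chart[OF f c]] by (simp add: VU)
    then show "smooth_on (\<phi> ` V) ((\<lambda>p. chart_deriv M (U, \<phi>) w p f) \<circ> inv_into U \<phi>)"
    proof (rule smooth_on_cong)
      show "open (\<phi> ` V)" using chart_open_image[OF c smooth_fun_on_openin[OF f]] by (simp add: VU)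
      fix y assume "y \<in> \<phi> ` V"
      then obtain q where q: "q \<in> V" "y = \<phi> q" by auto
      then have "inv_into U \<phi> y = q" using chart_inj_on[OF c] V by auto
      \<comment> \<open>On \<open>V\<close> the smoothness test in \<open>chart_deriv\<close>
        succeeds everywhere, so only the derivative in the fixed direction \<open>w\<close>
        remains.\<close>
      then show "frechet_derivative (f \<circ> inv_into U \<phi>) (at y) w =
          ((\<lambda>p. chart_deriv M (U, \<phi>) w p f) \<circ> inv_into U \<phi>) y"
        using smooth_nearI[OF f q(1)] q by (simp add: chart_deriv_def)
    qed
  qed
qed

section \<open>Coordinate expansion of tensorial maps\<close>

text \<open>Inside one chart domain the coordinate fields exist on all of \<open>W\<close>, so
  \<open>X\<close> can be expanded there with smooth coefficients and without cutoff functions. The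
  assumption \<open>cong\<close> is what allows this, as the expansion agrees with \<open>X\<close>
  only on \<open>W\<close>.\<close>

lemma tensorial_expand:
  fixes F :: "'a field \<Rightarrow> real"
  assumes c: "(U, \<phi>) \<in> charts M" and W: "p \<in> W" "W \<subseteq> U" and X: "vector_field_on M W X"
    and add: "\<And>X Y. vector_field_on M W X \<Longrightarrow> vector_field_on M W Y \<Longrightarrow> F (X + Y) = F X + F Y"
    and scale: "\<And>f X. smooth_fun_on M W f \<Longrightarrow> vector_field_on M W X \<Longrightarrow> F (f \<odot> X) = f p * F X"
    and cong: "\<And>X Y. vector_field_on M W X \<Longrightarrow> vector_field_on M W Y \<Longrightarrow>
      (\<And>q. q \<in> W \<Longrightarrow> X q = Y q) \<Longrightarrow> F X = F Y"
  shows "F X = (\<Sum>i\<in>UNIV. X p (\<lambda>q. \<phi> q $ i) * F (chart_deriv M (U, \<phi>) (axis i 1)))"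
proof -
  let ?E = "\<lambda>i. chart_deriv M (U, \<phi>) (axis i 1)"
  let ?f = "\<lambda>i q. X q (\<lambda>q. \<phi> q $ i)"
  have W': "openin (mtop M) W" using vector_field_on_openin[OF X] .
  have E: "vector_field_on M W (?E i)" for i
    using vector_field_on_subset[OF vector_field_on_coordinate[OF c] W' W(2)] .
  have f: "smooth_fun_on M W (?f i)" for i
    using vector_field_on_smooth[OF X smooth_fun_on_subset[OF smooth_fun_on_coordinate[OF c] W' W(2)]]
    by simp
  \<comment> \<open>The zero field is a multiple of \<open>X\<close>, so homogeneity gives both that
    it is a field on \<open>W\<close> and that \<open>F\<close> vanishes on it. This starts the
    induction.\<close>
  have 0: "(\<lambda>_. 0) \<odot> X = 0" by (simp add: fscale_def fun_eq_iff)
  have 0: "vector_field_on M W 0" "F 0 = 0"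
    using vector_field_on_fscale[OF smooth_fun_on_const[OF W', of 0] X]
      scale[OF smooth_fun_on_const[OF W', of 0] X] by (simp_all only: 0 mult_zero_left)
  have *: "vector_field_on M W (\<Sum>i\<in>I. ?f i \<odot> ?E i) \<and> F (\<Sum>i\<in>I. ?f i \<odot> ?E i) = (\<Sum>i\<in>I. ?f i p * F (?E i))"
    if "finite I" for I
    using that
  proof (induction I)
    case (insert i I)
    show ?case
      unfolding sum.insert[OF insert.hyps]
      using insert.IH vector_field_on_add[OF vector_field_on_fscale[OF f E]]
        add[OF vector_field_on_fscale[OF f E]] scale[OF f E] by (simp only: simp_thms)
  qed (simp only: 0 sum.empty)
  have "F X = F (\<Sum>i\<in>UNIV. ?f i \<odot> ?E i)"
  proof (rule cong[OF X])
    fix q assume "q \<in> W"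
    then have "X q = (\<Sum>i\<in>UNIV. ?f i q *\<^sub>R ?E i q)"
      using tangent_expand[OF c] vector_field_on_tangent[OF X] W(2) by blast
    then show "X q = (\<Sum>i\<in>UNIV. ?f i \<odot> ?E i) q"
      by (simp add: sum_fun_apply fscale_def)
  qed (use * in auto)
  then show ?thesis using * by simp
qed

lemma linear_at_expand:
  fixes L :: "'a tvec \<Rightarrow> 'b::real_vector"
  assumes c: "(U, \<phi>) \<in> charts M" and p: "p \<in> U" and v: "v \<in> tangent_space M p"
    and L: "linear_at M p L"
  shows "L v = (\<Sum>i\<in>UNIV. v (\<lambda>q. \<phi> q $ i) *\<^sub>R L (chart_deriv M (U, \<phi>) (axis i 1) p))"
proof -
  let ?E = "\<lambda>i. chart_deriv M (U, \<phi>) (axis i 1) p"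
  have T: "subspace (tangent_space M p)"
    using tangent_subspace openin_topspace_mem[OF chart_openin[OF c] p] by blast
  have E: "?E i \<in> tangent_space M p" for i using tangent_space_chart[OF c p] by blast
  have L0: "L 0 = 0"
    using L v unfolding linear_at_def by (metis scaleR_zero_left)
  \<comment> \<open>\<open>linear_at\<close> grants linearity on tangent vectors only, so the
    induction must carry along that partial sums are tangent.\<close>
  have *: "(\<Sum>i\<in>I. k i *\<^sub>R ?E i) \<in> tangent_space M p \<and> L (\<Sum>i\<in>I. k i *\<^sub>R ?E i) = (\<Sum>i\<in>I. k i *\<^sub>R L (?E i))"
    if "finite I" for I and k :: "'n \<Rightarrow> real"
    using that
  proof (induction I)
    case empty
    then show ?case using L0 subspace_0[OF T] by (simp only: sum.empty simp_thms)
  next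
    case (insert i I)
    then show ?case
      using L E[of i] subspace_add[OF T] subspace_scale[OF T E[of i], of "k i"]
      unfolding linear_at_def sum.insert[OF insert.hyps] by (simp only: simp_thms)
  qed
  show ?thesis
    using *[of UNIV "\<lambda>i. v (\<lambda>q. \<phi> q $ i)"] tangent_expand[OF c p v] by simp
qed

lemma linear_at_uminus: "linear_at M p L \<Longrightarrow> v \<in> tangent_space M p \<Longrightarrow> L (- v) = - L v"
  unfolding linear_at_def by (metis scaleR_minus1_left)

lemma linear_at_diff:
  "linear_at M p L \<Longrightarrow> p \<in> topspace (mtop M) \<Longrightarrow> v \<in> tangent_space M p \<Longrightarrow> w \<in> tangent_space M p \<Longrightarrow>
    L (v - w) = L v - L w"
  using linear_at_uminus[of p L w] subspace_neg[OF tangent_subspace, of p w]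
  unfolding linear_at_def by (metis add_uminus_conv_diff)

section \<open>The Jacobi identity\<close>

lemma lie_bracket_smooth_near:
  "smooth_near M p f \<Longrightarrow> lie_bracket M X Y p f = X p (\<lambda>q. Y q f) - Y p (\<lambda>q. X q f)"
  by (simp add: lie_bracket_def)

text \<open>The bracket is the commutator only on functions smooth near the point. As
  \<open>f\<close> is smooth on all of \<open>W\<close>, the replacement is valid near
  \<open>p\<close>, which is all that \<open>X p\<close> sees.\<close>

lemma lie_bracket_apply_apply:
  assumes X: "vector_field_on M W X" and Y: "vector_field_on M W Y" and Z: "vector_field_on M W Z"
    and p: "p \<in> W" and f: "smooth_fun_on M W f"
  shows "X p (\<lambda>q. lie_bracket M Y Z q f) = X p (\<lambda>q. Y q (\<lambda>r. Z r f)) - X p (\<lambda>q. Z q (\<lambda>r. Y r f))"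
proof -
  have "X p (\<lambda>q. lie_bracket M Y Z q f) = X p (\<lambda>q. Y q (\<lambda>r. Z r f) - Z q (\<lambda>r. Y r f))"
    by (rule tangent_cong[OF vector_field_on_tangent[OF X p] vector_field_on_openin[OF X] p])
      (simp add: lie_bracket_smooth_near smooth_nearI[OF f])
  also have "\<dots> = X p (\<lambda>q. Y q (\<lambda>r. Z r f)) - X p (\<lambda>q. Z q (\<lambda>r. Y r f))"
    using vector_field_on_smooth[OF Y vector_field_on_smooth[OF Z f]]
      vector_field_on_smooth[OF Z vector_field_on_smooth[OF Y f]]
    by (intro tangent_diff[OF vector_field_on_tangent[OF X p]]) (auto intro: smooth_nearI[OF _ p])
  finally show ?thesis .
qed

text \<open>After shrinking to a neighbourhood where \<open>f\<close> is smooth, the twelve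
  threefold derivatives of \<open>f\<close> cancel in pairs. If there is no such neighbourhood,
  every bracket is 0 by definition.\<close>

lemma jacobi_identity:
  assumes X: "vector_field_on M W X" and Y: "vector_field_on M W Y" and Z: "vector_field_on M W Z"
    and p: "p \<in> W"
  shows "lie_bracket M X (lie_bracket M Y Z) p + lie_bracket M Y (lie_bracket M Z X) p
    + lie_bracket M Z (lie_bracket M X Y) p = 0"
proof
  fix f
  show "(lie_bracket M X (lie_bracket M Y Z) p + lie_bracket M Y (lie_bracket M Z X) p
    + lie_bracket M Z (lie_bracket M X Y) p) f = 0 f"
  proof (cases "smooth_near M p f")
    case True
    then obtain V where V: "p \<in> V" "smooth_fun_on M V f" by (auto simp: smooth_near_def)
    let ?V = "V \<inter> W"
    have o: "openin (mtop M) ?V"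
      using smooth_fun_on_openin[OF V(2)] vector_field_on_openin[OF X] by blast
    have f: "smooth_fun_on M ?V f" using smooth_fun_on_subset[OF V(2) o] by simp
    have p': "p \<in> ?V" using p V by simp
    have X': "vector_field_on M ?V X" and Y': "vector_field_on M ?V Y" and Z': "vector_field_on M ?V Z"
      using vector_field_on_subset[OF _ o] X Y Z by auto
    have Xf: "smooth_near M p (\<lambda>q. X q f)" and Yf: "smooth_near M p (\<lambda>q. Y q f)"
      and Zf: "smooth_near M p (\<lambda>q. Z q f)"
      using vector_field_on_smooth[OF X' f] vector_field_on_smooth[OF Y' f]
        vector_field_on_smooth[OF Z' f] by (auto intro: smooth_nearI[OF _ p'])
    show ?thesis
      by (simp add: lie_bracket_smooth_near[OF True] lie_bracket_apply_apply[OF X' Y' Z' p' f]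
          lie_bracket_apply_apply[OF Y' Z' X' p' f] lie_bracket_apply_apply[OF Z' X' Y' p' f]
          lie_bracket_smooth_near[OF Xf] lie_bracket_smooth_near[OF Yf] lie_bracket_smooth_near[OF Zf])
  qed (simp add: lie_bracket_def)
qed

section \<open>Traces in a chart and traces of skew matrices\<close>

text \<open>The chart chosen by \<open>trace_field\<close> depends on \<open>p\<close> but not on
  \<open>E\<close>, so all traces at \<open>p\<close> are computed in one coordinate basis.\<close>

lemma trace_field_chart:
  assumes "p \<in> topspace (mtop M)"
  obtains U \<phi> where "(U, \<phi>) \<in> charts M" "p \<in> U"
    "\<And>E. trace_field M E p = (\<Sum>i\<in>UNIV. E (chart_deriv M (U, \<phi>) (axis i 1)) p (\<lambda>q. \<phi> q $ i))"
proof -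
  define c where "c = (SOME c. c \<in> charts M \<and> p \<in> fst c)"
  have "c \<in> charts M \<and> p \<in> fst c"
    unfolding c_def by (rule someI_ex[OF chart_exists[OF assms]])
  then show ?thesis
    using that[of "fst c" "snd c"] by (simp add: trace_field_def c_def[symmetric] Let_def)
qed

end

text \<open>Positivity makes \<open>G\<close> invertible. Then the transpose of \<open>R\<close> is
  minus a conjugate of \<open>R\<close>, so \<open>trace R = - trace R\<close>.\<close>

lemma trace_skew_eq_0:
  fixes G R :: "real^'n^'n"
  assumes "transpose R ** G = - (G ** R)" "\<And>x. x \<noteq> 0 \<Longrightarrow> x \<bullet> (G *v x) > 0"
  shows "trace R = 0"
proof -
  have "\<forall>x. G *v x = 0 \<longrightarrow> x = 0"
    using assms(2) by (metis inner_zero_right less_irrefl)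
  then obtain H where HG: "H ** G = mat 1"
    using matrix_left_invertible_ker by blast
  then have GH: "G ** H = mat 1" by (simp add: matrix_left_right_inverse)
  have "trace R = trace (transpose R)" by (simp add: trace_def transpose_def)
  also have "transpose R = (transpose R ** G) ** H"
    by (simp add: matrix_mul_assoc[symmetric] GH)
  also have "\<dots> = - (G ** R ** H)"
    unfolding assms(1) by (simp add: matrix_matrix_mult_def vec_eq_iff sum_negf)
  also have "trace (- (G ** R ** H)) = - trace (G ** R ** H)"
    by (simp add: trace_def sum_negf)
  also have "trace (G ** R ** H) = trace R"
    by (metis trace_mul_sym HG matrix_mul_assoc matrix_mul_lid)
  finally show ?thesis by simp
qed

section \<open>Curvature of the Levi-Civita connection\<close>

locale riemannian_manifold = manifold M
  for M :: "('a, 'n::finite) atlas_space" +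
  fixes g :: "'a \<Rightarrow> 'a tvec \<Rightarrow> 'a tvec \<Rightarrow> real"
    and nabla :: "'a field \<Rightarrow> 'a field \<Rightarrow> 'a field"
  assumes metric: "riemannian_metric M g"
    and levi_civita: "levi_civita_connection M g nabla"
begin

abbreviation "vf \<equiv> vector_field_on M"

section \<open>Calculus of the Levi-Civita connection\<close>

lemma nabla_vector_field: "vf W X \<Longrightarrow> vf W Y \<Longrightarrow> vf W (nabla X Y)"
  and nabla_add_left: "vf W X \<Longrightarrow> vf W X' \<Longrightarrow> vf W Y \<Longrightarrow> p \<in> W \<Longrightarrow>
    nabla (X + X') Y p = nabla X Y p + nabla X' Y p"
  and nabla_add_right: "vf W X \<Longrightarrow> vf W Y \<Longrightarrow> vf W Y' \<Longrightarrow> p \<in> W \<Longrightarrow>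
    nabla X (Y + Y') p = nabla X Y p + nabla X Y' p"
  and nabla_fscale_left: "vf W X \<Longrightarrow> vf W Y \<Longrightarrow> smooth_fun_on M W f \<Longrightarrow> p \<in> W \<Longrightarrow>
    nabla (f \<odot> X) Y p = f p *\<^sub>R nabla X Y p"
  and nabla_fscale_right: "vf W X \<Longrightarrow> vf W Y \<Longrightarrow> smooth_fun_on M W f \<Longrightarrow> p \<in> W \<Longrightarrow>
    nabla X (f \<odot> Y) p = X p f *\<^sub>R Y p + f p *\<^sub>R nabla X Y p"
  and nabla_cong: "vf W X \<Longrightarrow> vf W X' \<Longrightarrow> vf W Y \<Longrightarrow> vf W Y' \<Longrightarrow>
    (\<And>q. q \<in> W \<Longrightarrow> X q = X' q) \<Longrightarrow> (\<And>q. q \<in> W \<Longrightarrow> Y q = Y' q) \<Longrightarrow> p \<in> W \<Longrightarrow>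
    nabla X Y p = nabla X' Y' p"
proof -
  have conn: "linear_connection M nabla"
    using levi_civita by (simp only: levi_civita_connection_def)
  note conn = conn[unfolded linear_connection_def]
  have L: "vf W (nabla X Y) \<and>
      (\<forall>p\<in>W. nabla (X + X') Y p = nabla X Y p + nabla X' Y p \<and>
        nabla (f \<odot> X) Y p = f p *\<^sub>R nabla X Y p \<and>
        nabla X (Y + Y') p = nabla X Y p + nabla X Y' p \<and>
        nabla X (f \<odot> Y) p = X p f *\<^sub>R Y p + f p *\<^sub>R nabla X Y p) \<and>
      ((\<forall>p\<in>W. X p = X' p \<and> Y p = Y' p) \<longrightarrow> (\<forall>p\<in>W. nabla X Y p = nabla X' Y' p))"
    if "vf W X" "vf W X'" "vf W Y" "vf W Y'" "smooth_fun_on M W f" for W X X' Y Y' f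
    by (rule mp[OF spec[OF spec[OF spec[OF spec[OF spec[OF spec[OF conn]]]]]]])
      (use that in simp)
  \<comment> \<open>The constant function 0 fills the function slot for those rules that do not
    mention \<open>f\<close>.\<close>
  note const = smooth_fun_on_const[OF vector_field_on_openin, of _ _ 0]
  show "vf W X \<Longrightarrow> vf W Y \<Longrightarrow> vf W (nabla X Y)"
    using L[of W X X Y Y, OF _ _ _ _ const] by blast
  show "vf W X \<Longrightarrow> vf W X' \<Longrightarrow> vf W Y \<Longrightarrow> p \<in> W \<Longrightarrow> nabla (X + X') Y p = nabla X Y p + nabla X' Y p"
    using L[of W X X' Y Y, OF _ _ _ _ const] by blast
  show "vf W X \<Longrightarrow> vf W Y \<Longrightarrow> vf W Y' \<Longrightarrow> p \<in> W \<Longrightarrow> nabla X (Y + Y') p = nabla X Y p + nabla X Y' p"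
    using L[of W X X Y Y', OF _ _ _ _ const] by blast
  show "vf W X \<Longrightarrow> vf W Y \<Longrightarrow> smooth_fun_on M W f \<Longrightarrow> p \<in> W \<Longrightarrow> nabla (f \<odot> X) Y p = f p *\<^sub>R nabla X Y p"
    using L[of W X X Y Y f] by blast
  show "vf W X \<Longrightarrow> vf W Y \<Longrightarrow> smooth_fun_on M W f \<Longrightarrow> p \<in> W \<Longrightarrow>
      nabla X (f \<odot> Y) p = X p f *\<^sub>R Y p + f p *\<^sub>R nabla X Y p"
    using L[of W X X Y Y f] by blast
  show "vf W X \<Longrightarrow> vf W X' \<Longrightarrow> vf W Y \<Longrightarrow> vf W Y' \<Longrightarrow>
    (\<And>q. q \<in> W \<Longrightarrow> X q = X' q) \<Longrightarrow> (\<And>q. q \<in> W \<Longrightarrow> Y q = Y' q) \<Longrightarrow> p \<in> W \<Longrightarrow>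
    nabla X Y p = nabla X' Y' p"
    using L[of W X X' Y Y', OF _ _ _ _ const] by blast
qed

lemma nabla_diff_right:
  assumes "vf W X" "vf W Y" "vf W Z" "p \<in> W"
  shows "nabla X (Y - Z) p = nabla X Y p - nabla X Z p"
  using nabla_add_right[OF assms(1) vector_field_on_diff[OF assms(2,3)] assms(3,4)]
  by (simp only: diff_add_cancel) (simp only: add_diff_cancel_right')

lemma nabla_uminus_left:
  assumes "vf W X" "vf W Y" "p \<in> W"
  shows "nabla (- X) Y p = - nabla X Y p"
proof -
  have "(\<lambda>_. -1) \<odot> X = - X" by (simp add: fscale_def fun_eq_iff)
  then show ?thesis
    using nabla_fscale_left[OF assms(1,2) smooth_fun_on_const[OF vector_field_on_openin[OF assms(1)], of "-1"] assms(3)]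
    by (simp only: scaleR_minus1_left)
qed

lemma lie_bracket_eq:
  assumes "vf W X" "vf W Y" "p \<in> W"
  shows "lie_bracket M X Y p = (nabla X Y - nabla Y X) p"
proof -
  have "torsion M nabla X Y p = 0"
    using levi_civita assms unfolding levi_civita_connection_def by blast
  then have "(nabla X Y - nabla Y X) p - lie_bracket M X Y p = 0"
    by (simp only: torsion_def minus_apply)
  then show ?thesis by (simp only: right_minus_eq)
qed

text \<open>Vanishing torsion expresses the bracket by covariant derivatives, from which it inherits
  tangency and smoothness.\<close>

lemma lie_bracket_vector_field:
  assumes "vf W X" "vf W Y"
  shows "vf W (lie_bracket M X Y)"
  by (rule vector_field_on_cong[OF vector_field_on_diff[OF nabla_vector_field[OF assms]
          nabla_vector_field[OF assms(2,1)]]])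
    (simp only: lie_bracket_eq[OF assms])

section \<open>Algebraic symmetries of the curvature\<close>

lemma curvature_apply:
  "curvature M nabla X Y Z p =
    nabla X (nabla Y Z) p - nabla Y (nabla X Z) p - nabla (lie_bracket M X Y) Z p"
  by (simp only: curvature_def minus_apply)

lemma curvature_tangent:
  assumes "vf W X" "vf W Y" "vf W Z" "p \<in> W"
  shows "curvature M nabla X Y Z p \<in> tangent_space M p"
proof -
  have p: "p \<in> topspace (mtop M)"
    using openin_topspace_mem[OF vector_field_on_openin] assms by blast
  show ?thesis
    unfolding curvature_apply
    by (intro subspace_diff[OF tangent_subspace[OF p]] vector_field_on_tangent[OF _ assms(4)]
        nabla_vector_field lie_bracket_vector_field assms)
qed

lemma curvature_antisym:
  assumes "vf W X" "vf W Y" "vf W Z" "p \<in> W"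
  shows "curvature M nabla X Y Z p = - curvature M nabla Y X Z p"
proof -
  have "lie_bracket M X Y = - lie_bracket M Y X"
    by (simp add: lie_bracket_def fun_eq_iff)
  then have "nabla (lie_bracket M X Y) Z p = - nabla (lie_bracket M Y X) Z p"
    using nabla_uminus_left[OF lie_bracket_vector_field[OF assms(2,1)] assms(3,4)] by simp
  then show ?thesis
    by (simp add: curvature_apply)
qed

text \<open>By vanishing torsion, \<open>nabla X\<close> of \<open>[Y,Z]\<close> minus
  \<open>nabla [Y,Z]\<close> of \<open>X\<close> is \<open>[X,[Y,Z]]\<close>. Regrouping the cyclic
  sum of curvatures into three such expressions leaves the Jacobi identity.\<close>

lemma bianchi:
  assumes X: "vf W X" and Y: "vf W Y" and Z: "vf W Z" and p: "p \<in> W"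
  shows "curvature M nabla X Y Z p + curvature M nabla Y Z X p + curvature M nabla Z X Y p = 0"
proof -
  have *: "nabla X (nabla Y Z) p - nabla X (nabla Z Y) p - nabla (lie_bracket M Y Z) X p
      = lie_bracket M X (lie_bracket M Y Z) p"
    if X: "vf W X" and Y: "vf W Y" and Z: "vf W Z" for X Y Z
  proof -
    have "nabla X (lie_bracket M Y Z) p = nabla X (nabla Y Z - nabla Z Y) p"
      by (rule nabla_cong[OF X X lie_bracket_vector_field[OF Y Z]
            vector_field_on_diff[OF nabla_vector_field[OF Y Z] nabla_vector_field[OF Z Y]] refl
            lie_bracket_eq[OF Y Z] p])
    then show ?thesis
      using lie_bracket_eq[OF X lie_bracket_vector_field[OF Y Z] p]
        nabla_diff_right[OF X nabla_vector_field[OF Y Z] nabla_vector_field[OF Z Y] p]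
      by (simp only: minus_apply)
  qed
  show ?thesis
    using *[OF X Y Z] *[OF Y Z X] *[OF Z X Y] jacobi_identity[OF X Y Z p]
    unfolding curvature_apply by (simp only: algebra_simps)
qed

section \<open>Skewness of the curvature with respect to the metric\<close>

lemma metric_linear: "p \<in> topspace (mtop M) \<Longrightarrow> v \<in> tangent_space M p \<Longrightarrow> linear_at M p (g p v)"
  and metric_sym: "p \<in> topspace (mtop M) \<Longrightarrow> v \<in> tangent_space M p \<Longrightarrow> w \<in> tangent_space M p \<Longrightarrow>
    g p v w = g p w v"
  and metric_pos: "p \<in> topspace (mtop M) \<Longrightarrow> v \<in> tangent_space M p \<Longrightarrow> v \<noteq> 0 \<Longrightarrow> g p v v > 0"
  and metric_smooth: "vf W X \<Longrightarrow> vf W Y \<Longrightarrow> smooth_fun_on M W (\<lambda>q. g q (X q) (Y q))"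
  using metric by (simp_all add: riemannian_metric_def)

lemma metric_compatible:
  "vf W X \<Longrightarrow> vf W Y \<Longrightarrow> vf W Z \<Longrightarrow> p \<in> W \<Longrightarrow>
    X p (\<lambda>q. g q (Y q) (Z q)) = g p (nabla X Y p) (Z p) + g p (Y p) (nabla X Z p)"
  using levi_civita by (simp add: levi_civita_connection_def parallel_metric_def)

lemma metric_diff_right:
  "p \<in> topspace (mtop M) \<Longrightarrow> u \<in> tangent_space M p \<Longrightarrow> v \<in> tangent_space M p \<Longrightarrow> w \<in> tangent_space M p \<Longrightarrow>
    g p u (v - w) = g p u v - g p u w"
  using linear_at_diff metric_linear by blast

lemma metric_diff_left:
  "p \<in> topspace (mtop M) \<Longrightarrow> u \<in> tangent_space M p \<Longrightarrow> v \<in> tangent_space M p \<Longrightarrow> w \<in> tangent_space M p \<Longrightarrow>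
    g p (v - w) u = g p v u - g p w u"
  by (metis metric_diff_right metric_sym subspace_diff tangent_subspace)

text \<open>The two mixed terms trade places when \<open>X\<close> and \<open>Y\<close> are
  exchanged, so they disappear from the commutator of the two derivatives.\<close>

lemma metric_second_derivative:
  assumes X: "vf W X" and Y: "vf W Y" and Z: "vf W Z" and Z': "vf W Z'" and p: "p \<in> W"
  shows "X p (\<lambda>q. Y q (\<lambda>r. g r (Z r) (Z' r))) =
    g p (nabla X (nabla Y Z) p) (Z' p) + g p (nabla Y Z p) (nabla X Z' p) +
    (g p (nabla X Z p) (nabla Y Z' p) + g p (Z p) (nabla X (nabla Y Z') p))"
proof -
  note N = nabla_vector_field[OF Y Z] nabla_vector_field[OF Y Z']
  have "X p (\<lambda>q. Y q (\<lambda>r. g r (Z r) (Z' r))) =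
      X p (\<lambda>q. g q (nabla Y Z q) (Z' q) + g q (Z q) (nabla Y Z' q))"
    by (rule tangent_cong[OF vector_field_on_tangent[OF X p] vector_field_on_openin[OF X] p])
      (rule metric_compatible[OF Y Z Z'])
  also have "\<dots> = X p (\<lambda>q. g q (nabla Y Z q) (Z' q)) + X p (\<lambda>q. g q (Z q) (nabla Y Z' q))"
    using metric_smooth[OF N(1) Z'] metric_smooth[OF Z N(2)]
    by (intro tangent_add[OF vector_field_on_tangent[OF X p]]) (auto intro: smooth_nearI[OF _ p])
  finally show ?thesis
    by (simp only: metric_compatible[OF X N(1) Z' p] metric_compatible[OF X Z N(2) p])
qed

text \<open>The bracket acts on the function \<open>g(Z,Z')\<close> both as a commutator of second
  derivatives and, by metric compatibility, as a single derivative. The difference of the two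
  expressions is \<open>g(R(X,Y)Z,Z') + g(Z,R(X,Y)Z')\<close>.\<close>

lemma curvature_metric_skew:
  assumes X: "vf W X" and Y: "vf W Y" and Z: "vf W Z" and Z': "vf W Z'" and p: "p \<in> W"
  shows "g p (curvature M nabla X Y Z p) (Z' p) = - g p (Z p) (curvature M nabla X Y Z' p)"
proof -
  let ?f = "\<lambda>q. g q (Z q) (Z' q)"
  have p': "p \<in> topspace (mtop M)"
    using openin_topspace_mem[OF vector_field_on_openin[OF X] p] .
  note T = vector_field_on_tangent[OF _ p]
  note S = subspace_diff[OF tangent_subspace[OF p']]
  note L = lie_bracket_vector_field[OF X Y]
  have t: "nabla X (nabla Y Z) p \<in> tangent_space M p" "nabla Y (nabla X Z) p \<in> tangent_space M p"
    "nabla (lie_bracket M X Y) Z p \<in> tangent_space M p" if "vf W Z" for Z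
    using X Y L that by (auto intro!: T nabla_vector_field)
  have "lie_bracket M X Y p ?f = X p (\<lambda>q. Y q ?f) - Y p (\<lambda>q. X q ?f)"
    using lie_bracket_smooth_near smooth_nearI[OF metric_smooth[OF Z Z'] p] by blast
  moreover have "g p (curvature M nabla X Y Z p) (Z' p) =
      g p (nabla X (nabla Y Z) p) (Z' p) - g p (nabla Y (nabla X Z) p) (Z' p)
      - g p (nabla (lie_bracket M X Y) Z p) (Z' p)"
    unfolding curvature_apply
    by (simp only: metric_diff_left[OF p' T[OF Z']] S t[OF Z])
  moreover have "g p (Z p) (curvature M nabla X Y Z' p) =
      g p (Z p) (nabla X (nabla Y Z') p) - g p (Z p) (nabla Y (nabla X Z') p)
      - g p (Z p) (nabla (lie_bracket M X Y) Z' p)"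
    unfolding curvature_apply
    by (simp only: metric_diff_right[OF p' T[OF Z]] S t[OF Z'])
  ultimately show ?thesis
    using metric_second_derivative[OF X Y Z Z' p] metric_second_derivative[OF Y X Z Z' p]
      metric_compatible[OF L Z Z' p] by linarith
qed

section \<open>Vanishing traces and symmetry of the Ricci tensor\<close>

text \<open>The \<open>v i\<close> are the images of the coordinate basis under an endomorphism.
  With these as columns of \<open>R\<close> and the Gram matrix \<open>G\<close>, skewness becomes
  the matrix identity of \<open>trace_skew_eq_0\<close>. Stating it through images lets it serve
  both the curvature and \<open>A\<close>.\<close>

lemma skew_trace_eq_0:
  assumes c: "(U, \<phi>) \<in> charts M" and p: "p \<in> U"
    and v: "\<And>i. v i \<in> tangent_space M p"
    and skew: "\<And>i j. g p (v i) (chart_deriv M (U, \<phi>) (axis j 1) p) =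
      - g p (chart_deriv M (U, \<phi>) (axis i 1) p) (v j)"
  shows "(\<Sum>i\<in>UNIV. v i (\<lambda>q. \<phi> q $ i)) = 0"
proof -
  let ?E = "\<lambda>i. chart_deriv M (U, \<phi>) (axis i 1) p"
  define G :: "real^'n^'n" where "G = (\<chi> i j. g p (?E i) (?E j))"
  define R :: "real^'n^'n" where "R = (\<chi> k i. v i (\<lambda>q. \<phi> q $ k))"
  have p': "p \<in> topspace (mtop M)" using openin_topspace_mem[OF chart_openin[OF c] p] .
  have E: "?E i \<in> tangent_space M p" for i using tangent_space_chart[OF c p] by blast
  have exp: "g p u w = (\<Sum>k\<in>UNIV. w (\<lambda>q. \<phi> q $ k) * g p u (?E k))"
    if "u \<in> tangent_space M p" "w \<in> tangent_space M p" for u w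
    using linear_at_expand[OF c p that(2) metric_linear[OF p' that(1)]] by simp
  have "trace R = 0"
  proof (rule trace_skew_eq_0)
    have "(transpose R ** G) $ i $ j = - (G ** R) $ i $ j" for i j
    proof -
      have "(transpose R ** G) $ i $ j = (\<Sum>k\<in>UNIV. v i (\<lambda>q. \<phi> q $ k) * g p (?E j) (?E k))"
        using metric_sym[OF p' E E]
        by (simp add: matrix_matrix_mult_def transpose_def R_def G_def)
      also have "\<dots> = g p (v i) (?E j)"
        using exp[OF E v] metric_sym[OF p' E v] by simp
      also have "\<dots> = - (G ** R) $ i $ j"
        unfolding skew using exp[OF E v]
        by (simp add: matrix_matrix_mult_def R_def G_def mult.commute)
      finally show ?thesis .
    qed
    then show "transpose R ** G = - (G ** R)" by (simp add: vec_eq_iff)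
    fix x :: "real^'n" assume x: "x \<noteq> 0"
    let ?u = "chart_deriv M (U, \<phi>) x p"
    have u: "?u \<in> tangent_space M p" using tangent_space_chart[OF c p] by blast
    \<comment> \<open>Applying the vector to the coordinate functions recovers the components of
      \<open>x\<close>.\<close>
    have "?u \<noteq> 0"
      using x chart_deriv_coordinate[OF c p, of x] by (metis vec_eq_iff zero_fun_apply zero_index)
    moreover have "x \<bullet> (G *v x) = g p ?u ?u"
      using exp[OF u u] exp[OF E u] metric_sym[OF p' u E]
      by (simp add: chart_deriv_coordinate[OF c p] inner_vec_def matrix_vector_mult_def G_def mult.commute)
    ultimately show "x \<bullet> (G *v x) > 0" using metric_pos[OF p' u] by simp
  qed
  then show ?thesis by (simp add: trace_def R_def)
qed

lemma curvature_trace_eq_0: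
  assumes c: "(U, \<phi>) \<in> charts M" and p: "p \<in> U" "p \<in> W" and X: "vf W X" and Y: "vf W Y"
  shows "(\<Sum>i\<in>UNIV. curvature M nabla X Y (chart_deriv M (U, \<phi>) (axis i 1)) p (\<lambda>q. \<phi> q $ i)) = 0"
proof -
  \<comment> \<open>Coordinate fields live only on \<open>U\<close>, so everything is restricted to
    the common domain.\<close>
  have o: "openin (mtop M) (U \<inter> W)" using chart_openin[OF c] vector_field_on_openin[OF X] by blast
  have X: "vf (U \<inter> W) X" and Y: "vf (U \<inter> W) Y"
    and E: "\<And>w. vf (U \<inter> W) (chart_deriv M (U, \<phi>) w)"
    using vector_field_on_subset[OF _ o] X Y vector_field_on_coordinate[OF c] by blast+
  have p': "p \<in> U \<inter> W" using p by simp
  show ?thesis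
    by (rule skew_trace_eq_0[OF c p(1) curvature_tangent[OF X Y E p'] curvature_metric_skew[OF X Y E E p']])
qed

text \<open>Bianchi and antisymmetry give \<open>R(E,Y)Z - R(E,Z)Y = - R(Y,Z)E\<close>. Tracing over
  \<open>E\<close> kills the right-hand side.\<close>

lemma ricci_sym:
  assumes Y: "vf W Y" and Z: "vf W Z" and p: "p \<in> W"
  shows "ricci M (curvature M nabla) Y Z p = ricci M (curvature M nabla) Z Y p"
proof -
  have "p \<in> topspace (mtop M)" using openin_topspace_mem[OF vector_field_on_openin[OF Y] p] .
  then obtain U \<phi> where c: "(U, \<phi>) \<in> charts M" and pU: "p \<in> U" and
    tr: "\<And>E. trace_field M E p = (\<Sum>i\<in>UNIV. E (chart_deriv M (U, \<phi>) (axis i 1)) p (\<lambda>q. \<phi> q $ i))"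
    using trace_field_chart by blast
  let ?E = "\<lambda>i. chart_deriv M (U, \<phi>) (axis i 1)"
  have o: "openin (mtop M) (U \<inter> W)" using chart_openin[OF c] vector_field_on_openin[OF Y] by blast
  have Y': "vf (U \<inter> W) Y" and Z': "vf (U \<inter> W) Z" and E: "\<And>i. vf (U \<inter> W) (?E i)"
    using vector_field_on_subset[OF _ o] Y Z vector_field_on_coordinate[OF c] by blast+
  have p': "p \<in> U \<inter> W" using p pU by simp
  have "curvature M nabla (?E i) Y Z p f - curvature M nabla (?E i) Z Y p f = - curvature M nabla Y Z (?E i) p f"
    for i f
    using fun_cong[OF bianchi[OF E Y' Z' p', of i], of f] fun_cong[OF curvature_antisym[OF Z' E Y' p', of i], of f]
    by simp
  then have "ricci M (curvature M nabla) Y Z p - ricci M (curvature M nabla) Z Y p = 0"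
    unfolding ricci_def tr using curvature_trace_eq_0[OF c pU p Y Z]
    by (simp add: sum_subtractf[symmetric] sum_negf)
  then show ?thesis by simp
qed

end

section \<open>Pointwise bilinear maps and traces\<close>

lemma tapp_apply [simp]: "(T \<diamondop> X) p = T p (X p)"
  by (simp add: tapp_def)

lemma fscale_apply [simp]: "(f \<odot> X) p = f p *\<^sub>R X p"
  by (simp add: fscale_def)

lemma fscale_diff_left: "(f - h) \<odot> X = f \<odot> X - h \<odot> X"
  and fscale_diff_right: "f \<odot> (X - Y) = f \<odot> X - f \<odot> Y"
  by (simp_all add: fscale_def fun_eq_iff algebra_simps)

lemma trace_field_add: "trace_field M (\<lambda>X. E X + F X) p = trace_field M E p + trace_field M F p"
  and trace_field_diff: "trace_field M (\<lambda>X. E X - F X) p = trace_field M E p - trace_field M F p"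
  and trace_field_scaleR: "trace_field M (\<lambda>X. r *\<^sub>R E X) p = r * trace_field M E p"
  and trace_field_fscale: "trace_field M (\<lambda>X. f \<odot> E X) p = f p * trace_field M E p"
  by (simp_all add: trace_field_def Let_def sum.distrib sum_subtractf sum_distrib_left)

context manifold
begin

section \<open>Bilinear forms at a point\<close>

definition tensor_at :: "'a \<Rightarrow> ('a field \<Rightarrow> 'a field \<Rightarrow> 'a \<Rightarrow> real) \<Rightarrow> bool" where
  "tensor_at p D \<longleftrightarrow> (\<exists>B.
     (\<forall>v\<in>tangent_space M p. linear_at M p (B v) \<and> linear_at M p (\<lambda>u. B u v)) \<and>
     (\<forall>W X Y. vector_field_on M W X \<and> vector_field_on M W Y \<and> p \<in> W \<longrightarrow> D X Y p = B (X p) (Y p)))"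

lemma tensor_at_swap: "tensor_at p D \<Longrightarrow> tensor_at p (\<lambda>X Y. D Y X)"
  unfolding tensor_at_def
proof (elim exE)
  fix B assume "(\<forall>v\<in>tangent_space M p. linear_at M p (B v) \<and> linear_at M p (\<lambda>u. B u v)) \<and>
     (\<forall>W X Y. vector_field_on M W X \<and> vector_field_on M W Y \<and> p \<in> W \<longrightarrow> D X Y p = B (X p) (Y p))"
  then show "\<exists>B. (\<forall>v\<in>tangent_space M p. linear_at M p (B v) \<and> linear_at M p (\<lambda>u. B u v)) \<and>
     (\<forall>W X Y. vector_field_on M W X \<and> vector_field_on M W Y \<and> p \<in> W \<longrightarrow> D Y X p = B (X p) (Y p))"
    by (intro exI[of _ "\<lambda>u v. B v u"]) auto
qed

lemma linear_at_add_fun: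
  "linear_at M p L \<Longrightarrow> linear_at M p L' \<Longrightarrow> linear_at M p (\<lambda>v. L v + L' v)"
  by (simp add: linear_at_def algebra_simps)

lemma linear_at_cmult_fun:
  fixes L :: "'a tvec \<Rightarrow> real"
  shows "linear_at M p L \<Longrightarrow> linear_at M p (\<lambda>v. r * L v)"
  by (simp add: linear_at_def algebra_simps)

lemma tensor_at_add:
  assumes "tensor_at p D" "tensor_at p D'"
  shows "tensor_at p (\<lambda>X Y. D X Y + D' X Y)"
proof -
  from assms obtain B B' where
    B: "\<forall>v\<in>tangent_space M p. linear_at M p (B v) \<and> linear_at M p (\<lambda>u. B u v)"
    "\<forall>W X Y. vector_field_on M W X \<and> vector_field_on M W Y \<and> p \<in> W \<longrightarrow> D X Y p = B (X p) (Y p)"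
    and B': "\<forall>v\<in>tangent_space M p. linear_at M p (B' v) \<and> linear_at M p (\<lambda>u. B' u v)"
    "\<forall>W X Y. vector_field_on M W X \<and> vector_field_on M W Y \<and> p \<in> W \<longrightarrow> D' X Y p = B' (X p) (Y p)"
    unfolding tensor_at_def by (elim exE conjE)
  show ?thesis
    unfolding tensor_at_def
    by (rule exI[of _ "\<lambda>u v. B u v + B' u v"]) (use B B' in \<open>simp add: linear_at_add_fun\<close>)
qed

lemma tensor_at_scaleR:
  assumes "tensor_at p D"
  shows "tensor_at p (\<lambda>X Y. r *\<^sub>R D X Y)"
proof -
  from assms obtain B where
    B: "\<forall>v\<in>tangent_space M p. linear_at M p (B v) \<and> linear_at M p (\<lambda>u. B u v)"
    "\<forall>W X Y. vector_field_on M W X \<and> vector_field_on M W Y \<and> p \<in> W \<longrightarrow> D X Y p = B (X p) (Y p)"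
    unfolding tensor_at_def by (elim exE conjE)
  show ?thesis
    unfolding tensor_at_def
    by (rule exI[of _ "\<lambda>u v. r * B u v"]) (use B in \<open>simp add: linear_at_cmult_fun\<close>)
qed

lemma tensor_at_diff:
  assumes "tensor_at p D" "tensor_at p D'"
  shows "tensor_at p (\<lambda>X Y. D X Y - D' X Y)"
proof -
  have "D X Y + (-1) *\<^sub>R D' X Y = D X Y - D' X Y" for X Y by (simp add: fun_eq_iff)
  then show ?thesis using tensor_at_add[OF assms(1) tensor_at_scaleR[OF assms(2), of "-1"]] by simp
qed

lemma tensor_at_product:
  assumes "linear_at M p (\<alpha> p)" "linear_at M p (\<beta> p)"
  shows "tensor_at p (\<lambda>X Y. (\<alpha> \<diamondop> X) * (\<beta> \<diamondop> Y))"
  unfolding tensor_at_def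
  by (rule exI[of _ "\<lambda>u v. \<alpha> p u * \<beta> p v"])
    (use assms in \<open>simp add: linear_at_def algebra_simps\<close>)

section \<open>Traces of rank-one endomorphisms\<close>

text \<open>The diagonal entries are the components of \<open>V\<close> times the values of
  \<open>D\<close> on the coordinate fields. Their sum is the expansion of \<open>D V Z\<close> in
  its first slot.\<close>

lemma trace_field_left:
  assumes D: "tensor_at p D" and Z: "vector_field_on M W Z" and V: "vector_field_on M W V" and p: "p \<in> W"
  shows "trace_field M (\<lambda>X. D X Z \<odot> V) p = D V Z p"
proof -
  have "p \<in> topspace (mtop M)" using openin_topspace_mem[OF vector_field_on_openin[OF Z] p] .
  then obtain U \<phi> where c: "(U, \<phi>) \<in> charts M" and pU: "p \<in> U" and
    tr: "\<And>E. trace_field M E p = (\<Sum>i\<in>UNIV. E (chart_deriv M (U, \<phi>) (axis i 1)) p (\<lambda>q. \<phi> q $ i))"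
    using trace_field_chart by blast
  from D obtain B where
    B: "\<forall>v\<in>tangent_space M p. linear_at M p (B v) \<and> linear_at M p (\<lambda>u. B u v)"
    "\<forall>W X Y. vector_field_on M W X \<and> vector_field_on M W Y \<and> p \<in> W \<longrightarrow> D X Y p = B (X p) (Y p)"
    unfolding tensor_at_def by (elim exE conjE)
  let ?E = "\<lambda>i. chart_deriv M (U, \<phi>) (axis i 1)"
  have o: "openin (mtop M) (U \<inter> W)" using chart_openin[OF c] vector_field_on_openin[OF Z] by blast
  have Z': "vector_field_on M (U \<inter> W) Z" and E: "\<And>i. vector_field_on M (U \<inter> W) (?E i)"
    using vector_field_on_subset[OF _ o] Z vector_field_on_coordinate[OF c] by blast+
  have "D (?E i) Z p = B (?E i p) (Z p)" for i
    using B(2) Z' E pU p by blast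
  moreover have "D V Z p = B (V p) (Z p)" using B(2) V Z p by blast
  moreover have "B (V p) (Z p) = (\<Sum>i\<in>UNIV. V p (\<lambda>q. \<phi> q $ i) *\<^sub>R B (?E i p) (Z p))"
    using linear_at_expand[OF c pU vector_field_on_tangent[OF V p], of "\<lambda>u. B u (Z p)"]
      B(1) vector_field_on_tangent[OF Z p] by blast
  ultimately show ?thesis
    by (simp add: tr mult.commute)
qed

lemma trace_field_right:
  assumes "tensor_at p D" "vector_field_on M W Z" "vector_field_on M W V" "p \<in> W"
  shows "trace_field M (\<lambda>X. D Z X \<odot> V) p = D Z V p"
  using trace_field_left[OF tensor_at_swap[OF assms(1)] assms(2-4)] .

lemma trace_field_form:
  assumes \<alpha>: "linear_at M p (\<alpha> p)" and V: "vector_field_on M W V" and p: "p \<in> W"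
  shows "trace_field M (\<lambda>X. (\<alpha> \<diamondop> X) \<odot> V) p = \<alpha> p (V p)"
proof -
  have "p \<in> topspace (mtop M)" using openin_topspace_mem[OF vector_field_on_openin[OF V] p] .
  then obtain U \<phi> where c: "(U, \<phi>) \<in> charts M" and pU: "p \<in> U" and
    tr: "\<And>E. trace_field M E p = (\<Sum>i\<in>UNIV. E (chart_deriv M (U, \<phi>) (axis i 1)) p (\<lambda>q. \<phi> q $ i))"
    using trace_field_chart by blast
  show ?thesis
    using linear_at_expand[OF c pU vector_field_on_tangent[OF V p] \<alpha>]
    by (simp add: tr mult.commute)
qed

lemma trace_field_id:
  assumes "p \<in> topspace (mtop M)"
  shows "trace_field M (\<lambda>X. X) p = real CARD('n)"
proof -
  obtain U \<phi> where c: "(U, \<phi>) \<in> charts M" and pU: "p \<in> U" and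
    tr: "\<And>E. trace_field M E p = (\<Sum>i\<in>UNIV. E (chart_deriv M (U, \<phi>) (axis i 1)) p (\<lambda>q. \<phi> q $ i))"
    using trace_field_chart[OF assms] by blast
  show ?thesis by (simp add: tr chart_deriv_coordinate[OF c pU])
qed

end

context riemannian_manifold
begin

lemma trace_curvature_eq_0:
  assumes "vf W X" "vf W Y" "p \<in> W"
  shows "trace_field M (curvature M nabla X Y) p = 0"
proof -
  have "p \<in> topspace (mtop M)"
    using openin_topspace_mem[OF vector_field_on_openin[OF assms(1)] assms(3)] .
  then obtain U \<phi> where "(U, \<phi>) \<in> charts M" "p \<in> U" and
    "\<And>E. trace_field M E p = (\<Sum>i\<in>UNIV. E (chart_deriv M (U, \<phi>) (axis i 1)) p (\<lambda>q. \<phi> q $ i))"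
    using trace_field_chart by blast
  then show ?thesis using curvature_trace_eq_0 assms by simp
qed

section \<open>The covariant derivative of a 1-form as a tensor\<close>

lemma cov_form_add_left:
  assumes "one_form M \<pi>" "vf W X" "vf W X'" "vf W Y" "p \<in> W"
  shows "cov_form nabla \<pi> (X + X') Y p = cov_form nabla \<pi> X Y p + cov_form nabla \<pi> X' Y p"
proof -
  have "linear_at M p (\<pi> p)"
    using assms(1) openin_topspace_mem[OF vector_field_on_openin[OF assms(2)] assms(5)]
    by (simp add: one_form_def)
  then show ?thesis
    using nabla_add_left[OF assms(2-5)] vector_field_on_tangent[OF nabla_vector_field assms(5)] assms(2-4)
    by (simp add: cov_form_def linear_at_def)
qed

lemma cov_form_fscale_left:
  assumes "one_form M \<pi>" "vf W X" "vf W Y" "smooth_fun_on M W f" "p \<in> W"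
  shows "cov_form nabla \<pi> (f \<odot> X) Y p = f p * cov_form nabla \<pi> X Y p"
proof -
  have "linear_at M p (\<pi> p)"
    using assms(1) openin_topspace_mem[OF vector_field_on_openin[OF assms(2)] assms(5)]
    by (simp add: one_form_def)
  then show ?thesis
    using nabla_fscale_left[OF assms(2-5)] vector_field_on_tangent[OF nabla_vector_field[OF assms(2,3)] assms(5)]
    by (simp add: cov_form_def linear_at_def algebra_simps)
qed

lemma cov_form_add_right:
  assumes \<pi>: "one_form M \<pi>" and X: "vf W X" and Y: "vf W Y" and Y': "vf W Y'" and p: "p \<in> W"
  shows "cov_form nabla \<pi> X (Y + Y') p = cov_form nabla \<pi> X Y p + cov_form nabla \<pi> X Y' p"
proof -
  have lin: "linear_at M q (\<pi> q)" if "q \<in> W" for q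
    using \<pi> openin_topspace_mem[OF vector_field_on_openin[OF X] that] by (simp add: one_form_def)
  have sm: "smooth_near M p (\<pi> \<diamondop> Y)" "smooth_near M p (\<pi> \<diamondop> Y')"
    using \<pi> Y Y' p by (auto simp: one_form_def intro!: smooth_nearI)
  have "X p (\<pi> \<diamondop> (Y + Y')) = X p (\<lambda>q. (\<pi> \<diamondop> Y) q + (\<pi> \<diamondop> Y') q)"
    by (rule tangent_cong[OF vector_field_on_tangent[OF X p] vector_field_on_openin[OF X] p])
      (use lin vector_field_on_tangent[OF Y] vector_field_on_tangent[OF Y'] in \<open>simp add: linear_at_def\<close>)
  then have "X p (\<pi> \<diamondop> (Y + Y')) = X p (\<pi> \<diamondop> Y) + X p (\<pi> \<diamondop> Y')"
    using tangent_add[OF vector_field_on_tangent[OF X p] sm] by simp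
  then show ?thesis
    using nabla_add_right[OF X Y Y' p] lin[OF p] vector_field_on_tangent[OF nabla_vector_field p] X Y Y'
    by (simp add: cov_form_def linear_at_def)
qed

text \<open>The term \<open>X(f) \<pi>(Y)\<close> arises once from differentiating
  \<open>\<pi>(fY)\<close> and once from the Leibniz rule of \<open>nabla\<close>, and
  cancels.\<close>

lemma cov_form_fscale_right:
  assumes \<pi>: "one_form M \<pi>" and X: "vf W X" and Y: "vf W Y" and f: "smooth_fun_on M W f" and p: "p \<in> W"
  shows "cov_form nabla \<pi> X (f \<odot> Y) p = f p * cov_form nabla \<pi> X Y p"
proof -
  have lin: "linear_at M q (\<pi> q)" if "q \<in> W" for q
    using \<pi> openin_topspace_mem[OF vector_field_on_openin[OF X] that] by (simp add: one_form_def)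
  have sm: "smooth_near M p f" "smooth_near M p (\<pi> \<diamondop> Y)"
    using \<pi> Y p f by (auto simp: one_form_def intro!: smooth_nearI)
  have T: "subspace (tangent_space M p)"
    using tangent_subspace openin_topspace_mem[OF vector_field_on_openin[OF X] p] by blast
  have "X p (\<pi> \<diamondop> (f \<odot> Y)) = X p (\<lambda>q. f q * (\<pi> \<diamondop> Y) q)"
    by (rule tangent_cong[OF vector_field_on_tangent[OF X p] vector_field_on_openin[OF X] p])
      (use lin vector_field_on_tangent[OF Y] in \<open>simp add: linear_at_def\<close>)
  then have 1: "X p (\<pi> \<diamondop> (f \<odot> Y)) = f p * X p (\<pi> \<diamondop> Y) + X p f * \<pi> p (Y p)"
    using tangent_mult[OF vector_field_on_tangent[OF X p] sm] by simp
  have Yp: "Y p \<in> tangent_space M p" "nabla X Y p \<in> tangent_space M p"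
    using vector_field_on_tangent[OF _ p] Y nabla_vector_field[OF X Y] by auto
  have "\<pi> p (X p f *\<^sub>R Y p + f p *\<^sub>R nabla X Y p) = X p f * \<pi> p (Y p) + f p * \<pi> p (nabla X Y p)"
    using lin[OF p] Yp subspace_scale[OF T Yp(1)] subspace_scale[OF T Yp(2)]
    unfolding linear_at_def real_scaleR_def[symmetric] by (simp only: simp_thms)
  then show ?thesis
    using 1 nabla_fscale_right[OF X Y f p]
    by (simp add: cov_form_def algebra_simps)
qed

lemma cov_form_cong:
  assumes "vf W X" "vf W X'" "vf W Y" "vf W Y'"
    "\<And>q. q \<in> W \<Longrightarrow> X q = X' q" "\<And>q. q \<in> W \<Longrightarrow> Y q = Y' q" "p \<in> W"
  shows "cov_form nabla \<pi> X Y p = cov_form nabla \<pi> X' Y' p"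
proof -
  have "X p (\<pi> \<diamondop> Y) = X p (\<pi> \<diamondop> Y')"
    by (rule tangent_cong[OF vector_field_on_tangent[OF assms(1,7)] vector_field_on_openin[OF assms(1)] assms(7)])
      (simp add: assms(6))
  then show ?thesis
    using nabla_cong[OF assms] assms(5)[OF assms(7)] by (simp add: cov_form_def)
qed

text \<open>The bilinear form is assembled from the components in one chart.
  \<open>tensorial_expand\<close>, applied to the first slot and then to the second, identifies it
  with the covariant derivative.\<close>

lemma cov_form_tensor_at:
  assumes \<pi>: "one_form M \<pi>" and "p \<in> topspace (mtop M)"
  shows "tensor_at p (cov_form nabla \<pi>)"
proof -
  obtain U \<phi> where c: "(U, \<phi>) \<in> charts M" and pU: "p \<in> U"
    using chart_exists[OF assms(2)] by auto
  let ?E = "\<lambda>i. chart_deriv M (U, \<phi>) (axis i 1)"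
  define h where "h i j = cov_form nabla \<pi> (?E i) (?E j) p" for i j
  \<comment> \<open>Components are read off by applying \<open>u\<close> and \<open>v\<close> to the
    coordinate functions, which makes \<open>B\<close> bilinear by construction.\<close>
  define B where "B u v = (\<Sum>i\<in>UNIV. u (\<lambda>q. \<phi> q $ i) * (\<Sum>j\<in>UNIV. v (\<lambda>q. \<phi> q $ j) * h i j))" for u v
  have "cov_form nabla \<pi> X Y p = B (X p) (Y p)" if X: "vf W X" and Y: "vf W Y" and p: "p \<in> W" for W X Y
  proof -
    have o: "openin (mtop M) (U \<inter> W)" using chart_openin[OF c] vector_field_on_openin[OF X] by blast
    have X: "vf (U \<inter> W) X" and Y: "vf (U \<inter> W) Y" and E: "\<And>i. vf (U \<inter> W) (?E i)"
      using vector_field_on_subset[OF _ o] X Y vector_field_on_coordinate[OF c] by blast+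
    have p: "p \<in> U \<inter> W" using p pU by simp
    have "cov_form nabla \<pi> X Y p = (\<Sum>i\<in>UNIV. X p (\<lambda>q. \<phi> q $ i) * cov_form nabla \<pi> (?E i) Y p)"
      by (rule tensorial_expand[OF c p _ X, where F = "\<lambda>X. cov_form nabla \<pi> X Y p"])
        (auto intro: cov_form_add_left[OF \<pi> _ _ Y p] cov_form_fscale_left[OF \<pi> _ Y _ p]
          cov_form_cong[OF _ _ Y Y _ _ p])
    moreover have "cov_form nabla \<pi> (?E i) Y p = (\<Sum>j\<in>UNIV. Y p (\<lambda>q. \<phi> q $ j) * h i j)" for i
      unfolding h_def
      by (rule tensorial_expand[OF c p _ Y, where F = "\<lambda>Y. cov_form nabla \<pi> (?E i) Y p"])
        (auto intro: cov_form_add_right[OF \<pi> E _ _ p] cov_form_fscale_right[OF \<pi> E _ _ p]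
          cov_form_cong[OF E E _ _ _ _ p])
    ultimately show ?thesis by (simp add: B_def)
  qed
  note val = this
  have lin: "linear_at M p (B v)" "linear_at M p (\<lambda>u. B u v)" for v
    by (simp_all add: linear_at_def B_def algebra_simps sum.distrib sum_distrib_left)
  show ?thesis
    unfolding tensor_at_def
  proof (intro exI[of _ B] conjI ballI allI impI lin)
    fix W X Y assume "vf W X \<and> vf W Y \<and> p \<in> W"
    then show "cov_form nabla \<pi> X Y p = B (X p) (Y p)" by (elim conjE) (rule val)
  qed
qed

end

section \<open>Ricci tensors and cancellation of the generator\<close>

text \<open>An almost Hermitian manifold with its Levi-Civita connection and a 1-form. The bound
  \<open>card_ge_2\<close> makes \<open>n - 1\<close> nonzero.\<close>

locale hermitian_manifold_with_form = riemannian_manifold M g nabla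
  for M :: "('a, 'n::finite) atlas_space" and g nabla +
  fixes A :: "'a \<Rightarrow> 'a tvec \<Rightarrow> 'a tvec" and \<pi> :: "'a \<Rightarrow> 'a tvec \<Rightarrow> real"
  assumes A_endomorphism: "endomorphism_field M A"
    and A_square: "\<And>p v. p \<in> topspace (mtop M) \<Longrightarrow> v \<in> tangent_space M p \<Longrightarrow> A p (A p v) = - v"
    and A_isometry: "\<And>p v w. p \<in> topspace (mtop M) \<Longrightarrow> v \<in> tangent_space M p \<Longrightarrow>
      w \<in> tangent_space M p \<Longrightarrow> g p (A p v) (A p w) = g p v w"
    and \<pi>_form: "one_form M \<pi>"
    and card_ge_2: "CARD('n) \<ge> 2"
begin

section \<open>Properties of \<open>A\<close> and of the tensors \<open>D\<close>\<close>

lemma A_vector_field: "vf W X \<Longrightarrow> vf W (A \<diamondop> X)"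
  and A_linear: "p \<in> topspace (mtop M) \<Longrightarrow> linear_at M p (A p)"
  and A_tangent: "p \<in> topspace (mtop M) \<Longrightarrow> v \<in> tangent_space M p \<Longrightarrow> A p v \<in> tangent_space M p"
  using A_endomorphism by (auto simp: endomorphism_field_def)

lemma \<pi>_linear: "p \<in> topspace (mtop M) \<Longrightarrow> linear_at M p (\<pi> p)"
  using \<pi>_form by (simp add: one_form_def)

lemma A_skew:
  assumes p: "p \<in> topspace (mtop M)" and v: "v \<in> tangent_space M p" and w: "w \<in> tangent_space M p"
  shows "g p (A p v) w = - g p v (A p w)"
proof -
  note Tv = A_tangent[OF p v] and Tw = A_tangent[OF p w]
  have "g p (A p v) w = g p (- v) (A p w)"
    using A_isometry[OF p Tv w] A_square[OF p v] by simp
  \<comment> \<open>Linearity of the metric is stated in its second argument, so the sign is moved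
    there by symmetry.\<close>
  also have "\<dots> = g p (A p w) (- v)"
    using metric_sym[OF p subspace_neg[OF tangent_subspace[OF p] v] Tw] .
  also have "\<dots> = - g p v (A p w)"
    using linear_at_uminus[OF metric_linear[OF p Tw] v] metric_sym[OF p Tw v] by simp
  finally show ?thesis .
qed

lemma trace_A_eq_0:
  assumes p: "p \<in> topspace (mtop M)"
  shows "trace_field M (\<lambda>X. A \<diamondop> X) p = 0"
proof -
  obtain U \<phi> where c: "(U, \<phi>) \<in> charts M" and pU: "p \<in> U" and
    tr: "\<And>E. trace_field M E p = (\<Sum>i\<in>UNIV. E (chart_deriv M (U, \<phi>) (axis i 1)) p (\<lambda>q. \<phi> q $ i))"
    using trace_field_chart[OF p] by blast
  have E: "chart_deriv M (U, \<phi>) w p \<in> tangent_space M p" for w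
    using tangent_space_chart[OF c pU] by blast
  show ?thesis
    using skew_trace_eq_0[OF c pU A_tangent[OF p E] A_skew[OF p E E]] by (simp add: tr)
qed

lemma linear_at_\<pi>_A:
  assumes p: "p \<in> topspace (mtop M)"
  shows "linear_at M p (\<lambda>v. \<pi> p (A p v))"
  using A_linear[OF p] \<pi>_linear[OF p] A_tangent[OF p] unfolding linear_at_def by simp

lemma product_tensor_at:
  assumes p: "p \<in> topspace (mtop M)"
  shows "tensor_at p (\<lambda>X Y. (\<pi> \<diamondop> X) * (\<pi> \<diamondop> A \<diamondop> Y))"
proof -
  have "(\<lambda>p v. \<pi> p (A p v)) \<diamondop> Y = \<pi> \<diamondop> A \<diamondop> Y" for Y by (simp add: fun_eq_iff)
  then show ?thesis
    using tensor_at_product[of p \<pi> "\<lambda>p v. \<pi> p (A p v)", OF \<pi>_linear[OF p] linear_at_\<pi>_A[OF p]] by simp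
qed

lemma D_tensor_at:
  assumes p: "p \<in> topspace (mtop M)"
  shows "tensor_at p (D0 nabla A \<pi>)" "tensor_at p (D1 nabla \<pi>)"
    "tensor_at p (D2 nabla A \<pi>)" "tensor_at p (D3 nabla A \<pi>)"
proof -
  note h = cov_form_tensor_at[OF \<pi>_form p] and q = product_tensor_at[OF p]
  have e: "D0 nabla A \<pi> = (\<lambda>X Y. cov_form nabla \<pi> X Y
     + (1/2) *\<^sub>R ((\<pi> \<diamondop> X) * (\<pi> \<diamondop> A \<diamondop> Y)) + (1/2) *\<^sub>R ((\<pi> \<diamondop> Y) * (\<pi> \<diamondop> A \<diamondop> X)))"
    "D1 nabla \<pi> = (\<lambda>X Y. cov_form nabla \<pi> X Y - cov_form nabla \<pi> Y X)"
    "D2 nabla A \<pi> = (\<lambda>X Y. cov_form nabla \<pi> X Y + (\<pi> \<diamondop> Y) * (\<pi> \<diamondop> A \<diamondop> X))"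
    "D3 nabla A \<pi> = (\<lambda>X Y. cov_form nabla \<pi> X Y + (\<pi> \<diamondop> X) * (\<pi> \<diamondop> A \<diamondop> Y))"
    by (intro ext, simp only: D0_def D1_def D2_def D3_def)+
  show "tensor_at p (D0 nabla A \<pi>)" "tensor_at p (D1 nabla \<pi>)"
    "tensor_at p (D2 nabla A \<pi>)" "tensor_at p (D3 nabla A \<pi>)"
    unfolding e
    by (intro tensor_at_add tensor_at_diff tensor_at_scaleR h q tensor_at_swap[OF q] tensor_at_swap[OF h])+
qed

text \<open>As total functions \<open>A \<diamondop> A \<diamondop> X\<close> and \<open>- X\<close>
  may differ, since the square of \<open>A\<close> is known only on tangent vectors. The rewriting
  therefore passes through the bilinear form at \<open>p\<close>.\<close>

lemma tensor_at_A_square: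
  assumes D: "tensor_at p D" and X: "vf W X" and Y: "vf W Y" and p: "p \<in> W"
  shows "D (A \<diamondop> A \<diamondop> X) Y p = - D X Y p" "D X (A \<diamondop> A \<diamondop> Y) p = - D X Y p"
proof -
  have p': "p \<in> topspace (mtop M)" using openin_topspace_mem[OF vector_field_on_openin[OF X] p] .
  from D obtain B where
    B: "\<forall>v\<in>tangent_space M p. linear_at M p (B v) \<and> linear_at M p (\<lambda>u. B u v)"
    and val: "\<forall>W X Y. vf W X \<and> vf W Y \<and> p \<in> W \<longrightarrow> D X Y p = B (X p) (Y p)"
    unfolding tensor_at_def by (elim exE conjE)
  have val: "D X Y p = B (X p) (Y p)" if "vf W X" "vf W Y" for X Y
    using val that p by blast
  note T = vector_field_on_tangent[OF X p] vector_field_on_tangent[OF Y p]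
  have lin: "linear_at M p (B (X p))" "linear_at M p (\<lambda>u. B u (Y p))"
    using B T by blast+
  show "D (A \<diamondop> A \<diamondop> X) Y p = - D X Y p" "D X (A \<diamondop> A \<diamondop> Y) p = - D X Y p"
    using linear_at_uminus[OF lin(1) T(2)] linear_at_uminus[OF lin(2) T(1)]
    by (simp_all add: val A_vector_field X Y A_square[OF p'] T)
qed

abbreviation "Ric \<equiv> ricci M (curvature M nabla)"

section \<open>Ricci tensors of the curvature tensors at a fixed point\<close>

context
  fixes W p
  assumes p: "p \<in> W" "p \<in> topspace (mtop M)"
begin

text \<open>These rules split a curvature tensor into multiples of the identity, multiples of
  \<open>A\<close> and rank-one maps, and evaluate each trace.\<close>

lemmas trace_rules =
  trace_field_add trace_field_diff trace_field_scaleR trace_field_fscale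
  trace_A_eq_0[OF p(2)] trace_field_id[OF p(2)]
  D_tensor_at[OF p(2), THEN trace_field_left, OF _ _ p(1)]
  D_tensor_at[OF p(2), THEN trace_field_right, OF _ _ p(1)]
  trace_field_form[where \<alpha> = \<pi>, OF \<pi>_linear[OF p(2)] _ p(1)]
  fscale_diff_left fscale_diff_right

text \<open>The last term is the trace of \<open>X \<mapsto> \<pi>(Y)X - \<pi>(X)Y\<close>, namely
  \<open>(n - 1) \<pi>(Y)\<close>, times \<open>\<pi>(Z)/4\<close>.\<close>

lemma ricci_R0:
  assumes "vf W Y" "vf W Z"
  shows "ricci M (R0 nabla A \<pi> M) Y Z p = Ric Y Z p
    - (1/2) * (D0 nabla A \<pi> (A \<diamondop> Z) Y p - D0 nabla A \<pi> Y (A \<diamondop> Z) p)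
    - (1/2) * D0 nabla A \<pi> (A \<diamondop> Y) Z p
    + (real CARD('n) - 1) / 4 * (\<pi> p (Y p) * \<pi> p (Z p))"
  using assms
  by (simp add: ricci_def R0_def trace_rules A_vector_field) (simp add: field_simps)

lemma ricci_R1:
  assumes "vf W Y" "vf W Z"
  shows "ricci M (R1 nabla A \<pi> M) Y Z p = Ric Y Z p - D1 nabla \<pi> (A \<diamondop> Z) Y p"
  using assms
  by (simp add: ricci_def R1_def trace_rules A_vector_field)

lemma ricci_R2:
  assumes "vf W Y" "vf W Z"
  shows "ricci M (R2 nabla A \<pi> M) Y Z p = Ric Y Z p - D2 nabla A \<pi> (A \<diamondop> Y) Z p"
  using assms
  by (simp add: ricci_def R2_def trace_rules A_vector_field)

lemma ricci_R3:
  assumes "vf W Y" "vf W Z"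
  shows "ricci M (R3 nabla A \<pi> M) Y Z p = Ric Y Z p - D2 nabla A \<pi> (A \<diamondop> Z) Y p"
  using assms
  by (simp add: ricci_def R3_def trace_rules A_vector_field)

text \<open>The curvature and \<open>A\<close> are both trace-free, so only the rank-one term
  survives.\<close>

lemma ricci'_R3:
  assumes "vf W X" "vf W Y"
  shows "ricci' M (R3 nabla A \<pi> M) X Y p = D3 nabla A \<pi> Y (A \<diamondop> X) p"
  using assms trace_curvature_eq_0[OF assms p(1)]
  by (simp add: ricci'_def R3_def trace_rules A_vector_field)

lemma ricci_R5:
  assumes "vf W Y" "vf W Z"
  shows "ricci M (R5 nabla A \<pi> M) Y Z p = Ric Y Z p
    - (1/2) * (D2 nabla A \<pi> (A \<diamondop> Z) Y p - D3 nabla A \<pi> Y (A \<diamondop> Z) p)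
    - (1/2) * D3 nabla A \<pi> (A \<diamondop> Y) Z p
    + (real CARD('n) - 1) / 2 * (\<pi> p (Y p) * \<pi> p (Z p))"
  using assms
  by (simp add: ricci_def R5_def trace_rules A_vector_field) (simp add: field_simps)

lemma D_apply:
  "D0 nabla A \<pi> X Y p = cov_form nabla \<pi> X Y p
     + \<pi> p (X p) * \<pi> p (A p (Y p)) / 2 + \<pi> p (Y p) * \<pi> p (A p (X p)) / 2"
  "D1 nabla \<pi> X Y p = cov_form nabla \<pi> X Y p - cov_form nabla \<pi> Y X p"
  "D2 nabla A \<pi> X Y p = cov_form nabla \<pi> X Y p + \<pi> p (Y p) * \<pi> p (A p (X p))"
  "D3 nabla A \<pi> X Y p = cov_form nabla \<pi> X Y p + \<pi> p (X p) * \<pi> p (A p (Y p))"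
  by (simp_all add: D0_def D1_def D2_def D3_def)

lemmas D_A_square = D_tensor_at[OF p(2), THEN tensor_at_A_square(1), OF _ _ p(1)]
  D_tensor_at[OF p(2), THEN tensor_at_A_square(2), OF _ _ p(1)]

section \<open>Cancellation of the generator in the \<open>H\<close> tensors\<close>

text \<open>\<open>Ric1(Y,AX)\<close> contains \<open>- D1(AAX,Y) = D1(X,Y)\<close>, the negative of
  the coefficient of \<open>AZ\<close> in \<open>R1\<close>. The same effect of \<open>A\<close>
  applied twice drives the cancellations in the other \<open>H\<close> tensors.\<close>

lemma H1_apply:
  assumes "vf W X" "vf W Y"
  shows "H1 nabla A \<pi> M X Y Z p = curvature M nabla X Y Z p + Ric Y (A \<diamondop> X) p *\<^sub>R A p (Z p)"
  using assms
  by (simp add: H1_def R1_def ricci_R1 D_A_square A_vector_field)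
    (simp add: D_apply algebra_simps)

lemma H2_apply:
  assumes "vf W X" "vf W Y" "vf W Z"
  shows "H2 nabla A \<pi> M X Y Z p = curvature M nabla X Y Z p
    + Ric (A \<diamondop> X) Z p *\<^sub>R A p (Y p) - Ric (A \<diamondop> Y) Z p *\<^sub>R A p (X p)"
  using assms
  by (simp add: H2_def R2_def ricci_R2 D_A_square A_vector_field algebra_simps)

text \<open>The combination gathers what stands over \<open>n - 1\<close> in \<open>4 H0\<close>.
  The derivative terms cancel because \<open>2 D0 = D2 + D3\<close> and because \<open>D0\<close>
  and the covariant derivative of \<pi> have the same antisymmetric part \<open>D1\<close>.\<close>

lemma ricci_H0_coefficient:
  assumes X: "vf W X" and Z: "vf W Z"
  shows "4 * ricci M (R0 nabla A \<pi> M) X Z p - 2 * ricci M (R1 nabla A \<pi> M) X Z p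
      - ricci M (R3 nabla A \<pi> M) Z X p - ricci' M (R3 nabla A \<pi> M) (A \<diamondop> Z) (A \<diamondop> X) p
    = Ric X Z p + (real CARD('n) - 1) * (\<pi> p (X p) * \<pi> p (Z p))"
  using X Z ricci_sym[OF Z X p(1)]
  by (simp add: ricci_R0 ricci_R1 ricci_R3 ricci'_R3 D_A_square A_vector_field)
    (simp add: D_apply field_simps)

text \<open>The analogue for \<open>2 H5\<close>, resting on
  \<open>D2(U,V) - D3(V,U) = D1(U,V)\<close>.\<close>

lemma ricci_H5_coefficient:
  assumes X: "vf W X" and Y: "vf W Y"
  shows "2 * ricci M (R5 nabla A \<pi> M) X Y p - ricci M (R1 nabla A \<pi> M) X Y p
      - ricci' M (R3 nabla A \<pi> M) (A \<diamondop> Y) (A \<diamondop> X) p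
    = Ric X Y p + (real CARD('n) - 1) * (\<pi> p (X p) * \<pi> p (Y p))"
  using X Y
  by (simp add: ricci_R5 ricci_R1 ricci'_R3 D_A_square A_vector_field)
    (simp add: D_apply field_simps)

lemma H0_apply:
  assumes X: "vf W X" and Y: "vf W Y" and Z: "vf W Z"
  shows "4 * H0 nabla A \<pi> M X Y Z p f = 4 * curvature M nabla X Y Z p f
    + 2 * (Ric Y (A \<diamondop> X) p * A p (Z p) f)
    + Ric Z (A \<diamondop> X) p * A p (Y p) f - Ric Z (A \<diamondop> Y) p * A p (X p) f
    + (Ric X Z p * Y p f - Ric Y Z p * X p f) / (real CARD('n) - 1)"
proof -
  define k where "k = 1 / (real CARD('n) - 1)"
  have k: "k * (real CARD('n) - 1) = 1" using card_ge_2 by (simp add: k_def)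
  \<comment> \<open>Sorts the definition by the vectors \<open>X\<close>, \<open>Y\<close>,
    \<open>AX\<close>, \<open>AY\<close> and \<open>AZ\<close>.\<close>
  have "4 * H0 nabla A \<pi> M X Y Z p f = 4 * R0 nabla A \<pi> M X Y Z p f
    + k * ((4 * ricci M (R0 nabla A \<pi> M) X Z p - 2 * ricci M (R1 nabla A \<pi> M) X Z p
      - ricci M (R3 nabla A \<pi> M) Z X p - ricci' M (R3 nabla A \<pi> M) (A \<diamondop> Z) (A \<diamondop> X) p) * Y p f
      - (4 * ricci M (R0 nabla A \<pi> M) Y Z p - 2 * ricci M (R1 nabla A \<pi> M) Y Z p
      - ricci M (R3 nabla A \<pi> M) Z Y p - ricci' M (R3 nabla A \<pi> M) (A \<diamondop> Z) (A \<diamondop> Y) p) * X p f)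
    + 2 * (ricci M (R1 nabla A \<pi> M) Y (A \<diamondop> X) p * A p (Z p) f)
    + (ricci M (R3 nabla A \<pi> M) Z (A \<diamondop> X) p - ricci' M (R3 nabla A \<pi> M) (A \<diamondop> Z) X p) * A p (Y p) f
    - (ricci M (R3 nabla A \<pi> M) Z (A \<diamondop> Y) p - ricci' M (R3 nabla A \<pi> M) (A \<diamondop> Z) Y p) * A p (X p) f"
    by (simp add: H0_def Let_def k_def) (simp add: divide_simps, simp add: algebra_simps)
  \<comment> \<open>The part quadratic in \<pi> carries the factor \<open>k * (n - 1) = 1\<close>,
    so it is exactly opposite to the last term of \<open>4 R0\<close>.\<close>
  also have "\<dots> = 4 * R0 nabla A \<pi> M X Y Z p f
    + k * (Ric X Z p * Y p f - Ric Y Z p * X p f)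
    + k * (real CARD('n) - 1) * (\<pi> p (Z p) * (\<pi> p (X p) * Y p f - \<pi> p (Y p) * X p f))
    + 2 * (ricci M (R1 nabla A \<pi> M) Y (A \<diamondop> X) p * A p (Z p) f)
    + (ricci M (R3 nabla A \<pi> M) Z (A \<diamondop> X) p - ricci' M (R3 nabla A \<pi> M) (A \<diamondop> Z) X p) * A p (Y p) f
    - (ricci M (R3 nabla A \<pi> M) Z (A \<diamondop> Y) p - ricci' M (R3 nabla A \<pi> M) (A \<diamondop> Z) Y p) * A p (X p) f"
    unfolding ricci_H0_coefficient[OF X Z] ricci_H0_coefficient[OF Y Z] by (simp add: algebra_simps)
  \<comment> \<open>\<open>Ric1(Y,AX)\<close> supplies \<open>D1(X,Y)\<close>, and
    \<open>Ric3(Z,AX) - Ric3'(AZ,X)\<close> supplies \<open>D2(X,Z) + D3(X,Z) = 2 D0(X,Z)\<close>.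
    These cancel the \<open>D0\<close> terms of \<open>4 R0\<close>.\<close>
  finally show ?thesis
    using X Y Z unfolding k
    by (simp add: R0_def ricci_R1 ricci_R3 ricci'_R3 D_A_square A_vector_field k_def)
      (simp add: D_apply algebra_simps)
qed

lemma H5_apply:
  assumes X: "vf W X" and Y: "vf W Y" and Z: "vf W Z"
  shows "2 * H5 nabla A \<pi> M X Y Z p f = 2 * curvature M nabla X Y Z p f
    + Ric Y (A \<diamondop> X) p * A p (Z p) f - Ric Z (A \<diamondop> Y) p * A p (X p) f
    + (Ric X Y p * Z p f - Ric Y Z p * X p f) / (real CARD('n) - 1)"
proof -
  define k where "k = 1 / (real CARD('n) - 1)"
  have k: "k * (real CARD('n) - 1) = 1" using card_ge_2 by (simp add: k_def)
  have "2 * H5 nabla A \<pi> M X Y Z p f = 2 * R5 nabla A \<pi> M X Y Z p f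
    + k * ((2 * ricci M (R5 nabla A \<pi> M) X Y p - ricci M (R1 nabla A \<pi> M) X Y p
      - ricci' M (R3 nabla A \<pi> M) (A \<diamondop> Y) (A \<diamondop> X) p) * Z p f
      - (2 * ricci M (R5 nabla A \<pi> M) Y Z p - ricci M (R1 nabla A \<pi> M) Y Z p
      - ricci' M (R3 nabla A \<pi> M) (A \<diamondop> Z) (A \<diamondop> Y) p) * X p f)
    + ricci M (R1 nabla A \<pi> M) Y (A \<diamondop> X) p * A p (Z p) f
    - ricci M (R3 nabla A \<pi> M) Z (A \<diamondop> Y) p * A p (X p) f
    - ricci' M (R3 nabla A \<pi> M) (A \<diamondop> Z) X p * A p (Y p) f"
    by (simp add: H5_def Let_def k_def) (simp add: divide_simps, simp add: algebra_simps)
  also have "\<dots> = 2 * R5 nabla A \<pi> M X Y Z p f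
    + k * (Ric X Y p * Z p f - Ric Y Z p * X p f)
    + k * (real CARD('n) - 1) * (\<pi> p (Y p) * (\<pi> p (X p) * Z p f - \<pi> p (Z p) * X p f))
    + ricci M (R1 nabla A \<pi> M) Y (A \<diamondop> X) p * A p (Z p) f
    - ricci M (R3 nabla A \<pi> M) Z (A \<diamondop> Y) p * A p (X p) f
    - ricci' M (R3 nabla A \<pi> M) (A \<diamondop> Z) X p * A p (Y p) f"
    unfolding ricci_H5_coefficient[OF X Y] ricci_H5_coefficient[OF Y Z] by (simp add: algebra_simps)
  \<comment> \<open>Each \<open>D\<close> term of \<open>2 R5\<close> meets its opposite:
    \<open>D1(X,Y)\<close> from \<open>Ric1(Y,AX)\<close>, \<open>D2(Y,Z)\<close> from
    \<open>Ric3(Z,AY)\<close> and \<open>D3(X,Z)\<close> from \<open>Ric3'(AZ,X)\<close>. The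
    \<pi>-part cancels since \<open>k * (n - 1) = 1\<close>.\<close>
  finally show ?thesis
    using X Y Z unfolding k
    by (simp add: R5_def ricci_R1 ricci_R3 ricci'_R3 D_A_square A_vector_field k_def)
      (simp add: D_apply algebra_simps)
qed

section \<open>The two relations with the Weyl projective tensor\<close>

lemma weyl_projective_apply:
  "weyl_projective M nabla X Y Z p f = curvature M nabla X Y Z p f
    + (Ric X Z p * Y p f - Ric Y Z p * X p f) / (real CARD('n) - 1)"
  by (simp add: weyl_projective_def Let_def)

lemma H0_H1_H2_weyl:
  assumes X: "vf W X" and Y: "vf W Y" and Z: "vf W Z"
  shows "(4 *\<^sub>R H0 nabla A \<pi> M X Y Z - 2 *\<^sub>R H1 nabla A \<pi> M X Y Z - H2 nabla A \<pi> M X Y Z) p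
    = weyl_projective M nabla X Y Z p"
proof
  fix f
  show "(4 *\<^sub>R H0 nabla A \<pi> M X Y Z - 2 *\<^sub>R H1 nabla A \<pi> M X Y Z - H2 nabla A \<pi> M X Y Z) p f
    = weyl_projective M nabla X Y Z p f"
    \<comment> \<open>\<open>H0\<close> and \<open>H2\<close> carry the Ricci tensor with its
      arguments in opposite order, hence the two uses of symmetry.\<close>
    using H0_apply[OF X Y Z, of f] ricci_sym[OF Z A_vector_field[OF X] p(1)]
      ricci_sym[OF Z A_vector_field[OF Y] p(1)]
    by (simp add: H1_apply[OF X Y] H2_apply[OF X Y Z] weyl_projective_apply)
qed

text \<open>\<open>H1(X,Y)Z\<close> and \<open>H1(Y,Z)X\<close> remove the two
  \<open>A\<close>-terms of \<open>2 H5\<close>. The curvatures left over are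
  \<open>R(X,Y)Z + R(Y,Z)X\<close>, which Bianchi turns into \<open>R(X,Z)Y\<close>.\<close>

lemma H5_H1_weyl:
  assumes X: "vf W X" and Y: "vf W Y" and Z: "vf W Z"
  shows "(2 *\<^sub>R H5 nabla A \<pi> M X Y Z - H1 nabla A \<pi> M X Y Z + H1 nabla A \<pi> M Y Z X) p
    = weyl_projective M nabla X Z Y p"
proof
  fix f
  have "curvature M nabla X Y Z p f + curvature M nabla Y Z X p f = curvature M nabla X Z Y p f"
    using fun_cong[OF bianchi[OF X Y Z p(1)], of f] fun_cong[OF curvature_antisym[OF Z X Y p(1)], of f]
    by simp
  then show "(2 *\<^sub>R H5 nabla A \<pi> M X Y Z - H1 nabla A \<pi> M X Y Z + H1 nabla A \<pi> M Y Z X) p f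
    = weyl_projective M nabla X Z Y p f"
    using H5_apply[OF X Y Z, of f] ricci_sym[OF Y Z p(1)]
    by (simp add: H1_apply[OF X Y] H1_apply[OF Y Z] weyl_projective_apply)
qed

end

end

theorem theorem5p1:
  fixes M :: "('a, 'n::finite) atlas_space"
    and g :: "'a \<Rightarrow> 'a tvec \<Rightarrow> 'a tvec \<Rightarrow> real"
    and A :: "'a \<Rightarrow> 'a tvec \<Rightarrow> 'a tvec"
    and \<pi> :: "'a \<Rightarrow> 'a tvec \<Rightarrow> real"
    and nabla nabla1 :: "'a field \<Rightarrow> 'a field \<Rightarrow> 'a field"
  assumes "kaehler_manifold M g A nabla"
    and "one_form M \<pi>"
    and "quarter_symmetric_metric_A_connection M g A \<pi> nabla1"
    and "\<And>W X Y p. vector_field_on M W X \<Longrightarrow> vector_field_on M W Y \<Longrightarrow> p \<in> W \<Longrightarrow>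
           nabla1 X Y p = nabla X Y p - ((\<pi> \<diamondop> X) \<odot> (A \<diamondop> Y)) p"
  shows "\<forall>X Y Z. vector_field M X \<and> vector_field M Y \<and> vector_field M Z \<longrightarrow>
           (\<forall>p\<in>topspace (mtop M).
              (4 *\<^sub>R H0 nabla A \<pi> M X Y Z - 2 *\<^sub>R H1 nabla A \<pi> M X Y Z - H2 nabla A \<pi> M X Y Z) p
                = weyl_projective M nabla X Y Z p \<and>
              (2 *\<^sub>R H5 nabla A \<pi> M X Y Z - H1 nabla A \<pi> M X Y Z + H1 nabla A \<pi> M Y Z X) p
                = weyl_projective M nabla X Z Y p)"
proof -
  interpret hermitian_manifold_with_form M g nabla A \<pi>
    by unfold_locales (use assms(1,2) in \<open>auto simp: kaehler_manifold_def\<close>)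
  show ?thesis
  proof (intro allI impI ballI, elim conjE)
    fix X Y Z p
    assume XYZ: "vector_field M X" "vector_field M Y" "vector_field M Z"
      and p: "p \<in> topspace (mtop M)"
    show "(4 *\<^sub>R H0 nabla A \<pi> M X Y Z - 2 *\<^sub>R H1 nabla A \<pi> M X Y Z - H2 nabla A \<pi> M X Y Z) p
        = weyl_projective M nabla X Y Z p \<and>
      (2 *\<^sub>R H5 nabla A \<pi> M X Y Z - H1 nabla A \<pi> M X Y Z + H1 nabla A \<pi> M Y Z X) p
        = weyl_projective M nabla X Z Y p"
      \<comment> \<open>For global fields the whole space serves as \<open>W\<close>, so
        \<open>p\<close> discharges both membership premises.\<close>
      using H0_H1_H2_weyl[OF p p XYZ] H5_H1_weyl[OF p p XYZ] by blast
  qed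
qed

end
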